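(* Let $L$ be a link with a diagram $D$ that is quasi-alternating at a crossing $c$, and let $L^{*}$ be a link obtained from $L$ by replacing the crossing $c$ in $D$ by a product of rational tangles that extends $c$. If the Jones polynomial $V_L(t)$ has no gaps, then the Jones polynomial $V_{L^{*}}(t)$ has no gaps.
   Context: Quasi-alternating links. The set $\mathcal{Q}$ of quasi-alternating links is the smallest set of links in $S^3$ such that: (i) the unknot belongs to $\mathcal{Q}$; (ii) if $L$ is a link with a diagram $D$ containing a crossing $c$ such that, writing $L_0,L_\infty$ for the links represented by the two smoothings of $D$ at $c$, one has $L_0,L_\infty\in\mathcal{Q}$, $\det(L_0),\det(L_\infty)\ge 1$ and $\det(L)=\det(L_0)+\det(L_\infty)$, then $L\in\mathcal{Q}$. In case (ii) one says that $L$ is quasi-alternating at the crossing $c$ with quasi-alternating diagram $D$. Here $\det(L)=|V_L(-1)|$ is the determinant. Jones polynomial. The Kauffman bracket $\langle D\rangle\in\mathbb{Z}[A^{-1},A]$ of an unoriented link diagram is defined by $\langle\bigcirc\rangle=1$, $\langle\bigcirc\cup D\rangle=(-A^{-2}-A^{2})\langle D\rangle$, and $\langle L\rangle=A\langle L_0\rangle+A^{-1}\langle L_\infty\rangle$, where $L_0$ and $L_\infty$ are the $A$-smoothing and the $A^{-1}$-smoothing of a crossing. For an oriented link $L$ with diagram $D$ of writhe $w(D)$ (number of positive crossings minus number of negative crossings), $V_L(t)=\left((-A)^{-3w(D)}\langle D\rangle\right)_{t^{1/2}=A^{-2}}\in\mathbb{Z}[t^{-1/2},t^{1/2}]$. One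 can always write $V_L(t)=t^{r}\sum_{i=0}^{m}a_it^{i}$ with $r \in \frac12\mathbb{Z}$, $m\ge0$, $a_i\in\mathbb{Z}$, $a_0\neq0$, $a_m\neq 0$. No gaps. $V_L(t)$ has no gaps if $a_ia_{i+1}\neq 0$ for all $0\le i\le m-1$. (For quasi-alternating links it is known that $a_ia_{i+1}\le 0$ for all $i$, so there this is the same as $a_ia_{i+1}<0$ for all $0\le i\le m-1$.) This property does not depend on the orientation of the link. Tangle replacement. Regard the crossing $c$ as a tangle with four marked endpoints, and let $\varepsilon(c)=\pm1$ according to whether its overstrand has positive or negative slope. A rational tangle with Conway notation $C(a_1,\dots,a_k)$ (obtained by successive alternate horizontal and vertical twisting by $a_1,\dots,a_k$ half twists) extends $c$ if it contains $c$ as one of its crossings and $\varepsilon(c)\,a_i\ge1$ for all $i$; in particular it is an alternating tangle diagram whose crossings are all of the same type as $c$. A product of rational tangles that extends $c$ is a tangle $\tau_1*\tau_2*\cdots*\tau_k$ ($k\ge1$) obtained by joining rational tangles $\tau_1,\dots,\tau_k$ one after another in a row (horizontally, or vertically), each of which extends $c$, meaning that each $\tau_j$ is a rational tangle with some Conway notation $C(b_1,\dots,b_n)$ (with $n$ and the $b_i$ depending on $j$) that contains $c$ as one of its crossings and satisfies $\varepsilon(c)\,b_i\ge1$ for all $i$. *)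

theory Defs
  imports Complex_Main "HOL-Library.Poly_Mapping"
begin

text \<open>
  Links in the 3-sphere are treated as link diagrams modulo Reidemeister moves.

  A planar diagram is put in general position with respect to the height function and cut into
  horizontal slices, each containing one minimum (\<open>Cup\<close>), one maximum (\<open>Cap\<close>) or one crossing;
  it is the list of its slices read from bottom to top.  Strands are numbered from left to right
  starting with 0, and the argument of a slice is the position of the leftmost strand involved:
  \<open>Cup i\<close> creates the strands \<open>i\<close> and \<open>i + 1\<close>, \<open>Cap i\<close> joins them, and \<open>Cross b i\<close> lets them cross.
  The overstrand of \<open>Cross True i\<close> has positive slope (it runs from bottom left to top right), the
  overstrand of \<open>Cross False i\<close> has negative slope.  Up to planar isotopy every diagram, with a
  chosen crossing in either of its two upright positions, has this form.
\<close>

datatype slice = Cup nat | Cap nat | Cross bool nat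

type_synonym diagram = "slice list"

fun shift :: "nat \<Rightarrow> slice \<Rightarrow> slice" where
  "shift k (Cup i) = Cup (k + i)"
| "shift k (Cap i) = Cap (k + i)"
| "shift k (Cross b i) = Cross b (k + i)"

text \<open>\<open>tangle n w m\<close>: \<open>w\<close> is a tangle diagram with \<open>n\<close> endpoints at the bottom and \<open>m\<close> at the top.\<close>

fun tangle :: "nat \<Rightarrow> diagram \<Rightarrow> nat \<Rightarrow> bool" where
  "tangle n [] m \<longleftrightarrow> n = m"
| "tangle n (Cup i # w) m \<longleftrightarrow> i \<le> n \<and> tangle (n + 2) w m"
| "tangle n (Cap i # w) m \<longleftrightarrow> i + 2 \<le> n \<and> tangle (n - 2) w m"
| "tangle n (Cross b i # w) m \<longleftrightarrow> i + 2 \<le> n \<and> tangle n w m"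

definition link_diagram :: "diagram \<Rightarrow> bool" where
  "link_diagram D \<longleftrightarrow> D \<noteq> [] \<and> tangle 0 D 0"


section \<open>Links\<close>

fun pos :: "slice \<Rightarrow> nat" where
  "pos (Cup i) = i"
| "pos (Cap i) = i"
| "pos (Cross b i) = i"

fun strands_in :: "slice \<Rightarrow> nat" where
  "strands_in (Cup i) = 0"
| "strands_in (Cap i) = 2"
| "strands_in (Cross b i) = 2"

fun strands_out :: "slice \<Rightarrow> nat" where
  "strands_out (Cup i) = 2"
| "strands_out (Cap i) = 0"
| "strands_out (Cross b i) = 2"

text \<open>
  The local moves realising planar isotopy of sliced diagrams: a slice \<open>t\<close> lying entirely to the
  right of \<open>s\<close> may be moved past it; a minimum and an adjacent maximum cancel; a strand crossing
  one leg of a minimum or maximum is slid to the other leg, whereby the crossing is rotated by a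
  quarter turn, so that the slope of its overstrand changes sign.
\<close>

inductive planar_move :: "diagram \<Rightarrow> diagram \<Rightarrow> bool" where
  far: "planar_move [s, shift (pos s + strands_out s) t] [shift (pos s + strands_in s) t, s]"
| straighten_left: "planar_move [Cup (i + 1), Cap i] []"
| straighten_right: "planar_move [Cup i, Cap (i + 1)] []"
| slide_cup: "planar_move [Cup i, Cross b (i + 1)] [Cup (i + 1), Cross (\<not> b) i]"
| slide_cap: "planar_move [Cross b (i + 1), Cap i] [Cross (\<not> b) i, Cap (i + 1)]"

text \<open>
  The variants of the Reidemeister moves not listed here follow from these and planar isotopy.
\<close>

inductive reidemeister_move :: "diagram \<Rightarrow> diagram \<Rightarrow> bool" where
  R1: "reidemeister_move [Cup (i + 1), Cross b i, Cap (i + 1)] []"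
| R2: "reidemeister_move [Cross b i, Cross (\<not> b) i] []"
| R3: "reidemeister_move [Cross b i, Cross b (i + 1), Cross b i]
                         [Cross b (i + 1), Cross b i, Cross b (i + 1)]"

definition diagram_step :: "diagram \<Rightarrow> diagram \<Rightarrow> bool" where
  "diagram_step D E \<longleftrightarrow> link_diagram D \<and> link_diagram E \<and>
     (\<exists>u l r v. (planar_move l r \<or> reidemeister_move l r) \<and> D = u @ l @ v \<and> E = u @ r @ v)"

definition isotopic :: "diagram \<Rightarrow> diagram \<Rightarrow> bool" where
  "isotopic = equivclp diagram_step"

text \<open>An unoriented link is identified with the set of all its diagrams.\<close>

type_synonym link = "diagram set"

definition link_of :: "diagram \<Rightarrow> link" where
  "link_of D = {E. isotopic D E}"

definition unknot :: link where
  "unknot = link_of [Cup 0, Cap 0]"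


section \<open>Orientations and writhe\<close>

text \<open>
  An orientation directs all strands at each of the \<open>length D + 1\<close> levels between the slices
  (\<open>True\<close> is upwards), consistently across each slice.
\<close>

fun coherent :: "slice \<Rightarrow> bool list \<Rightarrow> bool list \<Rightarrow> bool" where
  "coherent (Cup i) xs ys \<longleftrightarrow> (\<exists>d. ys = take i xs @ [d, \<not> d] @ drop i xs)"
| "coherent (Cap i) xs ys \<longleftrightarrow> (\<exists>d. xs = take i ys @ [d, \<not> d] @ drop i ys)"
| "coherent (Cross b i) xs ys \<longleftrightarrow> ys = xs[i := xs ! (i + 1), i + 1 := xs ! i]"

definition orientation :: "diagram \<Rightarrow> bool list list \<Rightarrow> bool" where
  "orientation D os \<longleftrightarrow> length os = length D + 1 \<and> os ! 0 = [] \<and>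
     (\<forall>k < length D. coherent (D ! k) (os ! k) (os ! (k + 1)))"

definition slope_sign :: "bool \<Rightarrow> int" where
  "slope_sign b = (if b then 1 else - 1)"

text \<open>With both strands directed upwards, a crossing is positive iff its overstrand has positive slope.\<close>

fun crossing_sign :: "slice \<Rightarrow> bool list \<Rightarrow> int" where
  "crossing_sign (Cross b i) xs = (if xs ! i = xs ! (i + 1) then slope_sign b else - slope_sign b)"
| "crossing_sign _ xs = 0"

definition writhe :: "diagram \<Rightarrow> bool list list \<Rightarrow> int" where
  "writhe D os = (\<Sum>k < length D. crossing_sign (D ! k) (os ! k))"


section \<open>Tangle replacement\<close>

definition is_crossing :: "diagram \<Rightarrow> nat \<Rightarrow> bool" where
  "is_crossing D c \<longleftrightarrow> c < length D \<and> (\<exists>b i. D ! c = Cross b i)"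

fun slope :: "slice \<Rightarrow> bool" where
  "slope (Cross b i) = b"
| "slope _ = undefined"

text \<open>Replacing the \<open>c\<close>-th slice, a crossing, by a tangle \<open>\<tau>\<close> with two endpoints at the bottom and at the top.\<close>

definition replace :: "diagram \<Rightarrow> nat \<Rightarrow> diagram \<Rightarrow> diagram" where
  "replace D c \<tau> = take c D @ map (shift (pos (D ! c))) \<tau> @ drop (c + 1) D"

definition tangle_0 :: diagram where  \<comment> \<open>two horizontal arcs\<close>
  "tangle_0 = [Cap 0, Cup 0]"

definition tangle_inf :: diagram where  \<comment> \<open>two vertical arcs\<close>
  "tangle_inf = []"

text \<open>
  The \<open>A\<close>-smoothing joins the two regions swept out when the overstrand is turned counterclockwise
  until it meets the understrand: top and bottom if the overstrand has positive slope.
\<close>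

definition smoothing_A :: "bool \<Rightarrow> diagram" where
  "smoothing_A b = (if b then tangle_inf else tangle_0)"

definition smoothing_B :: "bool \<Rightarrow> diagram" where
  "smoothing_B b = (if b then tangle_0 else tangle_inf)"

definition smooth_0 :: "diagram \<Rightarrow> nat \<Rightarrow> diagram" where
  "smooth_0 D c = replace D c (smoothing_A (slope (D ! c)))"

definition smooth_inf :: "diagram \<Rightarrow> nat \<Rightarrow> diagram" where
  "smooth_inf D c = replace D c (smoothing_B (slope (D ! c)))"


section \<open>Kauffman bracket and Jones polynomial\<close>

text \<open>\<open>int \<Rightarrow>\<^sub>0 int\<close> with its convolution product is the ring of integral Laurent polynomials.\<close>

type_synonym laurent = "int \<Rightarrow>\<^sub>0 int"

definition A_pow :: "int \<Rightarrow> laurent" where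
  "A_pow k = Poly_Mapping.single k 1"

definition loop_value :: laurent where
  "loop_value = - A_pow (- 2) - A_pow 2"

text \<open>
  The number of circles closed by a crossingless diagram.  The list attaches to each strand at the
  current level a label, such that two strands have the same label iff they are connected below
  that level; \<open>Suc (sum_list xs)\<close> is a label that does not occur in \<open>xs\<close>.
\<close>

fun loops :: "diagram \<Rightarrow> nat list \<Rightarrow> nat" where
  "loops [] xs = 0"
| "loops (Cup i # w) xs =
     loops w (take i xs @ [Suc (sum_list xs), Suc (sum_list xs)] @ drop i xs)"
| "loops (Cap i # w) xs =
     (let a = xs ! i; b = xs ! Suc i; ys = take i xs @ drop (i + 2) xs
      in if a = b then Suc (loops w ys)
         else loops w (map (\<lambda>x. if x = a then b else x) ys))"
| "loops (Cross b i # w) xs = undefined"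

text \<open>The crossings of the second argument are resolved one by one; the first one is crossingless.\<close>

fun bracket_acc :: "diagram \<Rightarrow> diagram \<Rightarrow> laurent" where
  "bracket_acc u [] = loop_value ^ (loops u [] - 1)"
| "bracket_acc u (Cup i # w) = bracket_acc (u @ [Cup i]) w"
| "bracket_acc u (Cap i # w) = bracket_acc (u @ [Cap i]) w"
| "bracket_acc u (Cross b i # w) =
     A_pow 1 * bracket_acc (u @ map (shift i) (smoothing_A b)) w +
     A_pow (- 1) * bracket_acc (u @ map (shift i) (smoothing_B b)) w"

definition bracket :: "diagram \<Rightarrow> laurent" where
  "bracket D = bracket_acc [] D"

text \<open>
  \<open>bracket_unknot\<close>, \<open>bracket_skein\<close> and \<open>bracket_circle\<close> below are the three defining properties of
  the Kauffman bracket.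
\<close>

lemma bracket_unknot: "bracket [Cup 0, Cap 0] = 1"
  by (simp add: bracket_def)

lemma bracket_acc_skein:
  "bracket_acc p (u @ Cross b i # v) =
     A_pow 1 * bracket_acc p (u @ map (shift i) (smoothing_A b) @ v) +
     A_pow (- 1) * bracket_acc p (u @ map (shift i) (smoothing_B b) @ v)"
proof (induction p u rule: bracket_acc.induct)
  case (1 p)
  show ?case by (simp add: smoothing_A_def smoothing_B_def tangle_0_def tangle_inf_def)
qed (simp_all add: algebra_simps)

lemma bracket_skein:
  assumes "is_crossing D c"
  shows "bracket D = A_pow 1 * bracket (smooth_0 D c) + A_pow (- 1) * bracket (smooth_inf D c)"
proof -
  obtain b i where c: "c < length D" "D ! c = Cross b i"
    using assms by (auto simp: is_crossing_def)
  then have D: "D = take c D @ Cross b i # drop (c + 1) D"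
    by (metis id_take_nth_drop Suc_eq_plus1)
  have "bracket D = bracket_acc [] (take c D @ Cross b i # drop (c + 1) D)"
    using D by (simp add: bracket_def)
  also have "\<dots> = A_pow 1 * bracket (smooth_0 D c) + A_pow (- 1) * bracket (smooth_inf D c)"
    unfolding bracket_acc_skein
    using c by (simp add: bracket_def smooth_0_def smooth_inf_def replace_def)
  finally show ?thesis .
qed

definition crossingless :: "diagram \<Rightarrow> bool" where
  "crossingless w \<longleftrightarrow> (\<forall>b i. Cross b i \<notin> set w)"

lemma loops_circle:
  assumes "crossingless u" "tangle (length xs) u n" "i \<le> n"
  shows "loops (u @ Cup i # Cap i # v) xs = Suc (loops (u @ v) xs)"
  using assms
proof (induction u xs arbitrary: n rule: loops.induct)
  case (1 xs)
  then show ?case by (simp add: nth_append)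
next
  case (2 j w xs)
  then show ?case using "2.IH"[of n] by (simp add: crossingless_def)
next
  case (3 j w xs)
  then show ?case using "3.IH"(1)[OF refl refl refl, of n] "3.IH"(2)[OF refl refl refl, of n]
    by (simp add: crossingless_def Let_def)
next
  case (4 b j w xs)
  then show ?case by (auto simp: crossingless_def)
qed

text \<open>The label lists occurring for a closed diagram contain each of their labels exactly twice.\<close>

definition paired :: "nat list \<Rightarrow> bool" where
  "paired xs \<longleftrightarrow> (\<forall>x. count_list xs x = 0 \<or> count_list xs x = 2)"

lemma paired_cup:
  assumes "paired xs"
  shows "paired (take i xs @ [Suc (sum_list xs), Suc (sum_list xs)] @ drop i xs)"
proof -
  let ?f = "Suc (sum_list xs)"
  have "?f \<notin> set xs"
    using member_le_sum_list[of "Suc (sum_list xs)" xs] by auto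
  then have "count_list xs ?f = 0" by simp
  moreover have "count_list (take i xs @ [?f, ?f] @ drop i xs) y =
      count_list xs y + (if y = ?f then 2 else 0)" for y
    using count_list_append[of "take i xs" "drop i xs" y] by simp
  ultimately show ?thesis
    using assms by (auto simp del: count_list_append simp: paired_def)
qed

lemma count_list_merge:
  "count_list (map (\<lambda>x. if x = a then b else x) ys) y =
     (if y = b then count_list ys b + (if a = b then 0 else count_list ys a)
      else if y = a then 0 else count_list ys y)"
  by (induction ys) auto

lemma paired_cap:
  fixes xs :: "nat list"
  assumes "paired xs" "i + 2 \<le> length xs"
  defines "ys \<equiv> take i xs @ drop (i + 2) xs"
  shows "xs ! i = xs ! Suc i \<Longrightarrow> paired ys"
    and "xs ! i \<noteq> xs ! Suc i \<Longrightarrow>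
           paired (map (\<lambda>x. if x = xs ! i then xs ! Suc i else x) ys)"
proof -
  have "xs = take i xs @ xs ! i # xs ! Suc i # drop (i + 2) xs"
    using assms(2) by (simp add: Cons_nth_drop_Suc)
  then have c: "count_list xs y = count_list ys y + (if xs ! i = y then 1 else 0)
      + (if xs ! Suc i = y then 1 else 0)" (is "_ = ?r") for y
  proof -
    assume "xs = take i xs @ xs ! i # xs ! Suc i # drop (i + 2) xs"
    then have "count_list xs y = count_list (take i xs @ xs ! i # xs ! Suc i # drop (i + 2) xs) y"
      by (rule arg_cong)
    also have "\<dots> = ?r" by (simp add: ys_def)
    finally show ?thesis .
  qed
  have d: "count_list xs y = 0 \<or> count_list xs y = 2" for y
    using assms(1) by (simp add: paired_def)
  show "paired ys" if e: "xs ! i = xs ! Suc i"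
    unfolding paired_def
  proof
    fix y show "count_list ys y = 0 \<or> count_list ys y = 2"
      using c[of y] d[of y] e by (auto split: if_splits)
  qed
  show "paired (map (\<lambda>x. if x = xs ! i then xs ! Suc i else x) ys)"
    if e: "xs ! i \<noteq> xs ! Suc i"
    unfolding paired_def count_list_merge
  proof
    fix y
    show "(if y = xs ! Suc i
         then count_list ys (xs ! Suc i) +
              (if xs ! i = xs ! Suc i then 0 else count_list ys (xs ! i))
         else if y = xs ! i then 0 else count_list ys y) = 0 \<or>
        (if y = xs ! Suc i
         then count_list ys (xs ! Suc i) +
              (if xs ! i = xs ! Suc i then 0 else count_list ys (xs ! i))
         else if y = xs ! i then 0 else count_list ys y) = 2"
      using c[of y] d[of y] c[of "xs ! i"] d[of "xs ! i"] c[of "xs ! Suc i"] d[of "xs ! Suc i"] e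
      by (auto split: if_splits)
  qed
qed

lemma loops_pos:
  assumes "crossingless w" "tangle (length xs) w 0" "paired xs" "w \<noteq> []"
  shows "loops w xs > 0"
  using assms
proof (induction w xs rule: loops.induct)
  case (1 xs)
  then show ?case by simp
next
  case (2 i w xs)
  then have "w \<noteq> []" by auto
  then show ?case
    using 2 paired_cup[of xs i] by (simp add: crossingless_def)
next
  case (3 i w xs)
  note t = "3.prems" and IH = "3.IH"
  have i: "i + 2 \<le> length xs" using t(2) by simp
  let ?ys = "take i xs @ drop (i + 2) xs"
  have len: "length ?ys = length xs - 2" using i by simp
  show ?case
  proof (cases "xs ! i = xs ! Suc i")
    case True
    then show ?thesis by (simp add: Let_def)
  next
    case False
    have "w \<noteq> []"
    proof
      assume "w = []"
      then have "length xs = 2" using t(2) i by simp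
      then obtain a b where ab: "xs = [a, b]"
        by (metis (no_types, lifting) One_nat_def Suc_1 length_0_conv length_Suc_conv)
      then have "a = b" using t(3) by (auto simp: paired_def dest!: spec[of _ a] split: if_splits)
      then show False using False ab i by (cases i) auto
    qed
    then show ?thesis
      using IH(2)[OF refl refl refl False] t len False paired_cap(2)[OF t(3) i False]
      by (simp add: crossingless_def Let_def del: map_append)
  qed
next
  case (4 b j w xs)
  then show ?case by (auto simp: crossingless_def)
qed


lemma tangle_append: "tangle n (u @ v) m \<longleftrightarrow> (\<exists>k. tangle n u k \<and> tangle k v m)"
proof (induction u arbitrary: n)
  case (Cons s u)
  then show ?case by (cases s) auto
qed simp

lemma tangle_unique: "tangle n w k \<Longrightarrow> tangle n w m \<Longrightarrow> k = m"
  by (induction n w m rule: tangle.induct) auto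

lemma tangle_smoothing:
  assumes "i + 2 \<le> n"
  shows "tangle n (map (shift i) (smoothing_A b)) n" "tangle n (map (shift i) (smoothing_B b)) n"
  using assms by (auto simp: smoothing_A_def smoothing_B_def tangle_0_def tangle_inf_def)

lemma crossingless_smoothing:
  "crossingless (map (shift i) (smoothing_A b))" "crossingless (map (shift i) (smoothing_B b))"
  by (auto simp: crossingless_def smoothing_A_def smoothing_B_def tangle_0_def tangle_inf_def)

lemma crossingless_append: "crossingless (u @ v) \<longleftrightarrow> crossingless u \<and> crossingless v"
  by (auto simp: crossingless_def)

lemma bracket_acc_circle:
  assumes "crossingless p" "crossingless q" "tangle 0 p n" "i \<le> n" "tangle n q m"
    and "tangle m v 0" "p @ q @ v \<noteq> []"
  shows "bracket_acc (p @ Cup i # Cap i # q) v = loop_value * bracket_acc (p @ q) v"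
  using assms
proof (induction v arbitrary: q m rule: measure_induct_rule[of length])
  case (less v)
  show ?case
  proof (cases v)
    case Nil
    have "loops (p @ Cup i # Cap i # q) [] = Suc (loops (p @ q) [])"
      using loops_circle[of p "[]" n i q] less.prems by simp
    moreover have "loops (p @ q) [] > 0"
      using loops_pos[of "p @ q" "[]"] less.prems Nil
      by (auto simp: crossingless_append tangle_append paired_def)
    ultimately show ?thesis
      using Nil by (simp add: power_eq_if)
  next
    case (Cons s w)
    have step: "bracket_acc (p @ Cup i # Cap i # q @ r) w = loop_value * bracket_acc (p @ q @ r) w"
      if "crossingless r" "tangle m r k" "tangle k w 0" "p @ q @ r @ w \<noteq> []" for r k
      using less.IH[of w "q @ r" k] that less.prems Cons
      by (auto simp: crossingless_append tangle_append)
    show ?thesis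
    proof (cases s)
      case (Cup j)
      then show ?thesis
        using step[of "[Cup j]" "m + 2"] less.prems Cons by (simp add: crossingless_def)
    next
      case (Cap j)
      then show ?thesis
        using step[of "[Cap j]" "m - 2"] less.prems Cons by (simp add: crossingless_def)
    next
      case (Cross b j)
      then have m: "j + 2 \<le> m" "tangle m w 0" using less.prems Cons by auto
      then have "w \<noteq> []" by auto
      then show ?thesis
        using step[OF crossingless_smoothing(1) tangle_smoothing(1)[OF m(1)] m(2), of b]
          step[OF crossingless_smoothing(2) tangle_smoothing(2)[OF m(1)] m(2), of b] Cons Cross
        by (simp add: algebra_simps)
    qed
  qed
qed

lemma bracket_circle:
  assumes "link_diagram (u @ v)" "tangle 0 u n" "i \<le> n"
  shows "bracket (u @ Cup i # Cap i # v) = loop_value * bracket (u @ v)"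
proof -
  have "bracket_acc p (u @ Cup i # Cap i # v) = loop_value * bracket_acc p (u @ v)"
    if "crossingless p" "tangle 0 p k" "tangle k u n" "tangle n v 0" "p @ u @ v \<noteq> []" for p k
    using that
  proof (induction u arbitrary: p k)
    case Nil
    then show ?case using bracket_acc_circle[of p "[]" n i n v] assms(3) by (simp add: crossingless_def)
  next
    case (Cons s u)
    have step: "bracket_acc (p @ r) (u @ Cup i # Cap i # v) = loop_value * bracket_acc (p @ r) (u @ v)"
      if "crossingless r" "tangle k r l" "tangle l u n" "p @ r @ u @ v \<noteq> []" for r l
      using Cons.IH[of "p @ r" l] that Cons.prems
      by (auto simp: crossingless_append tangle_append)
    show ?case
    proof (cases s)
      case (Cup j)
      then show ?thesis
        using step[of "[Cup j]" "k + 2"] Cons.prems by (simp add: crossingless_def)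
    next
      case (Cap j)
      then show ?thesis
        using step[of "[Cap j]" "k - 2"] Cons.prems by (simp add: crossingless_def)
    next
      case (Cross b j)
      then have k: "j + 2 \<le> k" "tangle k u n" using Cons.prems by auto
      then have "p \<noteq> []" using Cons.prems by auto
      then show ?thesis
        using step[OF crossingless_smoothing(1) tangle_smoothing(1)[OF k(1)] k(2), of b]
          step[OF crossingless_smoothing(2) tangle_smoothing(2)[OF k(1)] k(2), of b] Cross
        by (simp add: algebra_simps)
    qed
  qed
  from this[of "[]" 0] show ?thesis
    using assms by (auto simp: bracket_def crossingless_def link_diagram_def tangle_append
        dest: tangle_unique)
qed

text \<open>
  The polynomial \<open>V(t)\<close> of an oriented diagram, as a Laurent polynomial in \<open>t\<^sup>1\<^sup>/\<^sup>2\<close>: substituting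
  \<open>t\<^sup>1\<^sup>/\<^sup>2 = A\<^sup>-\<^sup>2\<close>, the coefficient at the \<open>k\<close>-th power of \<open>t\<^sup>1\<^sup>/\<^sup>2\<close> is the coefficient at the power
  \<open>- 2 * k\<close> of \<open>A\<close>.  (All exponents of \<open>A\<close> occurring here are even.)
\<close>

definition jones :: "diagram \<Rightarrow> bool list list \<Rightarrow> laurent" where
  "jones D os = Poly_Mapping.map_key (\<lambda>k. - 2 * k)
     (Poly_Mapping.single (- 3 * writhe D os) (if even (writhe D os) then 1 else - 1) * bracket D)"

text \<open>
  \<open>V\<close> is the Jones polynomial of the link \<open>L\<close> with one of its orientations, computed from one of
  its diagrams.
\<close>

definition jones_polynomial :: "link \<Rightarrow> laurent \<Rightarrow> bool" where
  "jones_polynomial L V \<longleftrightarrow> (\<exists>D os. D \<in> L \<and> orientation D os \<and> V = jones D os)"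

text \<open>
  \<open>V(-1)\<close>, with \<open>t\<^sup>1\<^sup>/\<^sup>2 = \<i>\<close>.  The other square root of \<open>-1\<close> and another orientation of the link give
  the same absolute value.
\<close>

definition eval_minus_one :: "laurent \<Rightarrow> complex" where
  "eval_minus_one V = (\<Sum>k \<in> Poly_Mapping.keys V. of_int (Poly_Mapping.lookup V k) * \<i> powi k)"

definition link_det :: "link \<Rightarrow> real" where
  "link_det L = (THE d. \<exists>V. jones_polynomial L V \<and> d = cmod (eval_minus_one V))"

text \<open>
  \<open>V(t)\<close> is \<open>t\<^sup>r\<close> times the sum of the \<open>a i * t ^ i\<close>; as \<open>V\<close> is a polynomial in \<open>t\<^sup>1\<^sup>/\<^sup>2\<close>, \<open>s\<close> stands
  for \<open>2 * r\<close>.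
\<close>

definition no_gaps :: "laurent \<Rightarrow> bool" where
  "no_gaps V \<longleftrightarrow> (\<exists>(s::int) (m::nat) (a::nat \<Rightarrow> int).
     V = (\<Sum>i\<le>m. Poly_Mapping.single (s + 2 * int i) (a i)) \<and>
     a 0 \<noteq> 0 \<and> a m \<noteq> 0 \<and> (\<forall>i<m. a i * a (i + 1) \<noteq> 0))"


section \<open>Quasi-alternating links\<close>

inductive_set quasi_alternating_links :: "link set" where
  unknot: "unknot \<in> quasi_alternating_links"
| resolve: "link_of D \<in> quasi_alternating_links"
    if "link_diagram D" "is_crossing D c"
      "link_of (smooth_0 D c) \<in> quasi_alternating_links"
      "link_of (smooth_inf D c) \<in> quasi_alternating_links"
      "link_det (link_of (smooth_0 D c)) \<ge> 1" "link_det (link_of (smooth_inf D c)) \<ge> 1"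
      "link_det (link_of D) = link_det (link_of (smooth_0 D c)) + link_det (link_of (smooth_inf D c))"

definition quasi_alternating_at :: "diagram \<Rightarrow> nat \<Rightarrow> bool" where
  "quasi_alternating_at D c \<longleftrightarrow> link_diagram D \<and> is_crossing D c \<and>
     link_of (smooth_0 D c) \<in> quasi_alternating_links \<and>
     link_of (smooth_inf D c) \<in> quasi_alternating_links \<and>
     link_det (link_of (smooth_0 D c)) \<ge> 1 \<and> link_det (link_of (smooth_inf D c)) \<ge> 1 \<and>
     link_det (link_of D) = link_det (link_of (smooth_0 D c)) + link_det (link_of (smooth_inf D c))"


section \<open>Products of rational tangles\<close>

text \<open>
  \<open>beside T S\<close> is \<open>T\<close> followed by \<open>S\<close> on its right: the extra minimum and maximum connect the
  right endpoints of \<open>T\<close> to the left endpoints of \<open>S\<close>.  \<open>above T S\<close> is \<open>T\<close> followed by \<open>S\<close> below it.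
\<close>

definition beside :: "diagram \<Rightarrow> diagram \<Rightarrow> diagram" where
  "beside T S = Cup 1 # T @ map (shift 2) S @ [Cap 1]"

definition above :: "diagram \<Rightarrow> diagram \<Rightarrow> diagram" where
  "above T S = S @ T"

text \<open>
  Twisting by \<open>a\<close> half twists adds \<open>\<bar>a\<bar>\<close> crossings on the right (\<open>h = True\<close>, horizontal) or at the
  bottom (\<open>h = False\<close>, vertical), with overstrands of positive slope iff \<open>a > 0\<close>.
\<close>

definition twist :: "bool \<Rightarrow> int \<Rightarrow> diagram \<Rightarrow> diagram" where
  "twist h a T = ((\<lambda>S. if h then beside S [Cross (a > 0) 0] else above S [Cross (a > 0) 0])
     ^^ nat \<bar>a\<bar>) T"

fun twists :: "bool \<Rightarrow> int list \<Rightarrow> diagram \<Rightarrow> diagram" where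
  "twists h [] T = T"
| "twists h (a # as) T = twists (\<not> h) as (twist h a T)"

text \<open>
  The rational tangle \<open>C(a\<^sub>1, \<dots>, a\<^sub>k)\<close>, whose first group of half twists is horizontal if \<open>h\<close> holds
  and vertical otherwise.
\<close>

definition conway :: "bool \<Rightarrow> int list \<Rightarrow> diagram" where
  "conway h as = twists h as (if h then tangle_0 else tangle_inf)"

text \<open>The parameter \<open>b\<close> tells whether the overstrand of the replaced crossing has positive slope.\<close>

definition rational_extends :: "bool \<Rightarrow> diagram \<Rightarrow> bool" where
  "rational_extends b \<tau> \<longleftrightarrow> (\<exists>h as. as \<noteq> [] \<and> \<tau> = conway h as \<and>
     (\<forall>a \<in> set as. slope_sign b * a \<ge> 1) \<and> (\<exists>i. Cross b i \<in> set \<tau>))"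

fun row :: "(diagram \<Rightarrow> diagram \<Rightarrow> diagram) \<Rightarrow> diagram list \<Rightarrow> diagram" where
  "row f [] = undefined"
| "row f [\<tau>] = \<tau>"
| "row f (\<tau> # \<tau>' # \<tau>s) = f \<tau> (row f (\<tau>' # \<tau>s))"

definition product_extends :: "bool \<Rightarrow> diagram \<Rightarrow> bool" where
  "product_extends b \<tau> \<longleftrightarrow> (\<exists>\<tau>s. \<tau>s \<noteq> [] \<and> (\<forall>\<sigma> \<in> set \<tau>s. rational_extends b \<sigma>) \<and>
     (\<tau> = row beside \<tau>s \<or> \<tau> = row above \<tau>s))"

end

theory Submission
  imports Defs "HOL-Analysis.Linear_Algebra"
begin

text \<open>
  Replacing the crossing \<open>c\<close> by a tangle \<open>\<tau>\<close> turns \<open>\<langle>D\<rangle> = Z + N\<close>, where \<open>Z\<close> and \<open>N\<close> are the contributions of the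
  two smoothings, into \<open>F Z + G N\<close>, where \<open>F\<close> and \<open>G\<close> depend only on \<open>\<tau>\<close>.  As \<open>D\<close> is quasi-alternating
  at \<open>c\<close>, equality holds in the triangle inequality for \<open>Z + N\<close> at an eighth root of unity;
  inductively, this means that up to one common unit \<open>Z\<close> and \<open>N\<close> have nonnegative coefficients in the
  variable \<open>- A\<^sup>4\<close>, so that no terms cancel.  For a product of rational tangles that extends \<open>c\<close>, also \<open>F\<close> and
  \<open>G\<close> have nonnegative coefficients up to a common unit, and their supports are intervals that intersect.
  Hence the support of \<open>F Z + G N\<close> is an interval if that of \<open>Z + N\<close> is one.

  The bracket is computed in the tensor powers of a two-dimensional representation of the
  Temperley--Lieb algebra, where invariance under the moves and the effect of replacing
  tangles are local computations.
\<close>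


section \<open>The Temperley--Lieb action on spin states\<close>

text \<open>An eighth root of unity enters because \<open>t = -1\<close> means
  \<open>A^(-2) = i\<close>; up to a factor of modulus 1 the Jones polynomial becomes the bracket
  there, so the determinant is the modulus of the bracket. Two obstacles shape the proof. The labels
  in \<open>loops\<close> depend on everything below the current level, so locality of the bracket
  is not visible in its definition; it has to be compared with a local model, and it suffices to do
  so for crossingless diagrams. The other obstacle is sign. For a horizontal product, up to a unit,
  the new \<open>G\<close> is \<open>F G' + G F' - (1 + B^4) G G'\<close> with \<open>B\<close>
  equal to \<open>A\<close> or its inverse, and nonnegativity is not apparent. A third polynomial
  \<open>H = F - (1 + B^4) G\<close> repairs this: the expression equals \<open>F G' + G H'\<close>.
  Up to a unit \<open>H\<close> is the bracket of the closure joining the two left endpoints and the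
  two right endpoints of the tangle; the closure of a horizontal product is a connected sum, so
  \<open>H\<close> is multiplicative.\<close>

lemma A_pow_0 [simp]: "A_pow 0 = 1"
  by (simp add: A_pow_def)

lemma A_pow_mult: "A_pow k * A_pow l = A_pow (k + l)"
  by (simp add: A_pow_def mult_single)

lemma A_pow_mult_left: "A_pow k * (A_pow l * P) = A_pow (k + l) * P"
  by (simp add: A_pow_mult flip: mult.assoc)

text \<open>
  The minimum is the tensor
  \<open>A e\<^sub>1 \<otimes> e\<^sub>2 - A\<^sup>-\<^sup>1 e\<^sub>2 \<otimes> e\<^sub>1\<close>, with \<open>True\<close> standing for \<open>1\<close>, and the maximum is its inverse matrix, which makes
  zigzags straighten and gives a circle the value \<open>- A\<^sup>2 - A\<^sup>-\<^sup>2\<close>.  The function \<open>f\<close> evaluates the part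
  of the diagram above the slice.
\<close>

definition cap_coeff :: "bool \<Rightarrow> bool \<Rightarrow> laurent" where
  "cap_coeff x y = (if x = y then 0 else if x then - A_pow 1 else A_pow (- 1))"

fun act :: "slice \<Rightarrow> (bool list \<Rightarrow> laurent) \<Rightarrow> bool list \<Rightarrow> laurent" where
  "act (Cup i) f s = A_pow 1 * f (take i s @ [True, False] @ drop i s)
     - A_pow (- 1) * f (take i s @ [False, True] @ drop i s)"
| "act (Cap i) f s = cap_coeff (s ! i) (s ! Suc i) * f (take i s @ drop (i + 2) s)"
| "act (Cross b i) f s = A_pow (slope_sign b) * f s
     + A_pow (- slope_sign b) * (cap_coeff (s ! i) (s ! Suc i) *
         (A_pow 1 * f (take i s @ [True, False] @ drop (i + 2) s)
          - A_pow (- 1) * f (take i s @ [False, True] @ drop (i + 2) s)))"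

definition acts :: "diagram \<Rightarrow> (bool list \<Rightarrow> laurent) \<Rightarrow> bool list \<Rightarrow> laurent" where
  "acts w f = foldr act w f"

lemma acts_Nil [simp]: "acts [] f = f"
  by (simp add: acts_def)

lemma acts_Cons [simp]: "acts (s # w) f = act s (acts w f)"
  by (simp add: acts_def)

lemma acts_append [simp]: "acts (u @ v) f = acts u (acts v f)"
  by (simp add: acts_def)

lemma act_linear: "act t (\<lambda>s. a * f s + b * g s) s = a * act t f s + b * act t g s"
  by (cases t) (simp_all add: algebra_simps)

lemma acts_linear: "acts w (\<lambda>s. a * f s + b * g s) = (\<lambda>s. a * acts w f s + b * acts w g s)"
  by (induction w) (auto simp: act_linear)

lemma acts_scale: "acts w (\<lambda>s. a * f s) = (\<lambda>s. a * acts w f s)"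
  using acts_linear[of w a f 0 f] by simp

text \<open>Together with the variants at \<open>Suc (length p)\<close> below, these rules replace
  \<open>act.simps\<close> in the simplifier: once a state is split at the position of the slice,
  each local identity is a finite computation on at most three spins.\<close>

lemma act_Cup [simp]:
  "act (Cup (length p)) f (p @ q) = A_pow 1 * f (p @ True # False # q) - A_pow (- 1) * f (p @ False # True # q)"
  by simp

lemma act_Cap [simp]: "act (Cap (length p)) f (p @ x # y # q) = cap_coeff x y * f (p @ q)"
  by (simp add: nth_append)

lemma act_Cross [simp]:
  "act (Cross b (length p)) f (p @ x # y # q) = A_pow (slope_sign b) * f (p @ x # y # q)
     + A_pow (- slope_sign b) * (cap_coeff x y *
        (A_pow 1 * f (p @ True # False # q) - A_pow (- 1) * f (p @ False # True # q)))"
  by (simp add: nth_append)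

declare act.simps [simp del]

lemma act_cong:
  assumes "tangle n [t] m" "\<And>s. length s = m \<Longrightarrow> f s = g s" "length s = n"
  shows "act t f s = act t g s"
  using assms by (cases t) (auto simp: act.simps)

lemma acts_cong:
  assumes "tangle n w m" "\<And>s. length s = m \<Longrightarrow> f s = g s" "length s = n"
  shows "acts w f s = acts w g s"
  using assms
proof (induction w arbitrary: n s)
  case (Cons t w)
  obtain k where k: "tangle n [t] k" "tangle k w m"
    using Cons.prems(1) tangle_append[of n "[t]" w m] by auto
  then show ?case
    using act_cong[OF k(1), of "acts w f" "acts w g" s] Cons by simp
qed simp

lemma act_shift: "act (shift (length p) t) f (p @ q) = act t (\<lambda>q'. f (p @ q')) q"
  by (cases t) (simp_all add: act.simps nth_append)

lemma act_local:
  assumes "pos t + strands_in t \<le> length p"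
  shows "act t f (p @ q) = act t (\<lambda>p'. f (p' @ q)) p"
  using assms by (cases t) (auto simp: act.simps nth_append)

text \<open>Both sides are the same double sum, since \<open>s\<close> and \<open>t\<close> act on
  separate arguments of \<open>g\<close>, as on two tensor factors.\<close>

lemma act_commute:
  "act s (\<lambda>p'. act t (\<lambda>q'. g p' q') q) p = act t (\<lambda>q'. act s (\<lambda>p'. g p' q') p) q"
  by (cases s; cases t) (simp_all add: act.simps algebra_simps)

text \<open>Cutting the state right after the strands entering \<open>s\<close> puts the two slices
  on different tensor factors. Past \<open>s\<close> the cut sits at
  \<open>pos s + strands_out s\<close>, which accounts for the two different shifts.\<close>

lemma act_far_aux:
  assumes "length p = pos s + strands_in s"
  shows "act s (\<lambda>s'. act (shift (pos s + strands_out s) t) f s') (p @ q)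
    = act (shift (pos s + strands_in s) t) (act s f) (p @ q)"
proof -
  let ?ni = "pos s + strands_in s" and ?no = "pos s + strands_out s"
  have "act s (act (shift ?no t) f) (p @ q) = act s (\<lambda>p'. act (shift ?no t) f (p' @ q)) p"
    using assms by (simp add: act_local)
  also have "\<dots> = act s (\<lambda>p'. act t (\<lambda>q'. f (p' @ q')) q) p"
  proof (rule act_cong[where n = ?ni and m = ?no])
    show "tangle ?ni [s] ?no" by (cases s) auto
    show "length p = ?ni" by (fact assms)
    show "act (shift ?no t) f (p' @ q) = act t (\<lambda>q'. f (p' @ q')) q" if "length p' = ?no" for p'
      using act_shift[of p' t f q] that by simp
  qed
  also have "\<dots> = act t (\<lambda>q'. act s (\<lambda>p'. f (p' @ q')) p) q"
    by (rule act_commute)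
  also have "\<dots> = act t (\<lambda>q'. act s f (p @ q')) q"
    using assms by (simp add: act_local)
  also have "\<dots> = act (shift ?ni t) (act s f) (p @ q)"
    using act_shift[of p t "act s f" q] assms by simp
  finally show ?thesis .
qed

lemma act_far:
  assumes "pos s + strands_in s \<le> length x"
  shows "act s (act (shift (pos s + strands_out s) t) f) x = act (shift (pos s + strands_in s) t) (act s f) x"
  using act_far_aux[of "take (pos s + strands_in s) x" s t f "drop (pos s + strands_in s) x"] assms
  by simp

section \<open>Isotopies, circles and Reidemeister moves as identities between operators on
  states\<close>

lemma list_split_at3:
  assumes "i + 3 \<le> length s"
  obtains p x y z q where "s = p @ x # y # z # q" "length p = i"
  using assms that[of "take i s" "s ! i" "s ! (i+1)" "s ! (i+2)" "drop (i+3) s"]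
  by (simp add: Cons_nth_drop_Suc numeral_eq_Suc)

lemma list_split_at2:
  assumes "i + 2 \<le> length s"
  obtains p x y q where "s = p @ x # y # q" "length p = i"
  using assms that[of "take i s" "s ! i" "s ! (i+1)" "drop (i+2) s"]
  by (simp add: Cons_nth_drop_Suc numeral_eq_Suc)

lemma list_split_at1:
  assumes "i + 1 \<le> length s"
  obtains p x q where "s = p @ x # q" "length p = i"
  using assms that[of "take i s" "s ! i" "drop (i+1) s"]
  by (simp add: Cons_nth_drop_Suc numeral_eq_Suc)

lemma act_Cup_Suc [simp]:
  "act (Cup (Suc (length p))) f (p @ x # q) = A_pow 1 * f (p @ x # True # False # q) - A_pow (- 1) * f (p @ x # False # True # q)"
  using act_Cup[of "p @ [x]"] by simp

lemma act_Cap_Suc [simp]: "act (Cap (Suc (length p))) f (p @ w # x # y # q) = cap_coeff x y * f (p @ w # q)"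
  using act_Cap[of "p @ [w]"] by simp

lemma act_Cross_Suc [simp]:
  "act (Cross b (Suc (length p))) f (p @ w # x # y # q) = A_pow (slope_sign b) * f (p @ w # x # y # q)
     + A_pow (- slope_sign b) * (cap_coeff x y *
        (A_pow 1 * f (p @ w # True # False # q) - A_pow (- 1) * f (p @ w # False # True # q)))"
  using act_Cross[of b "p @ [w]"] by simp

lemma act_Cup_Suc_Suc [simp]:
  "act (Cup (Suc (Suc (length p)))) f (p @ v # x # q) = A_pow 1 * f (p @ v # x # True # False # q) - A_pow (- 1) * f (p @ v # x # False # True # q)"
  using act_Cup[of "p @ [v, x]"] by simp

lemma act_Cap_Suc_Suc [simp]: "act (Cap (Suc (Suc (length p)))) f (p @ v # w # x # y # q) = cap_coeff x y * f (p @ v # w # q)"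
  using act_Cap[of "p @ [v, w]"] by simp

lemma act_straighten_left:
  assumes "i + 1 \<le> length s"
  shows "act (Cup (i + 1)) (act (Cap i) f) s = f s"
proof -
  obtain p x q where s: "s = p @ x # q" "i = length p" using list_split_at1[OF assms] by metis
  show ?thesis
    by (cases x) (simp_all add: s cap_coeff_def A_pow_mult A_pow_mult_left)
qed

lemma act_straighten_right:
  assumes "i + 1 \<le> length s"
  shows "act (Cup i) (act (Cap (i + 1)) f) s = f s"
proof -
  obtain p x q where s: "s = p @ x # q" "i = length p" using list_split_at1[OF assms] by metis
  show ?thesis
    by (cases x) (simp_all add: s cap_coeff_def A_pow_mult A_pow_mult_left)
qed

lemma act_circle:
  assumes "i \<le> length s"
  shows "act (Cup i) (act (Cap i) f) s = loop_value * f s"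
proof -
  obtain p q where s: "s = p @ q" "i = length p"
    using assms append_take_drop_id[of i s] by (metis length_take min.absorb2)
  show ?thesis
    by (simp add: s cap_coeff_def A_pow_mult A_pow_mult_left loop_value_def algebra_simps)
qed

lemma act_slide_cup:
  assumes "i + 1 \<le> length s"
  shows "act (Cup i) (act (Cross b (i + 1)) f) s = act (Cup (i + 1)) (act (Cross (\<not> b) i) f) s"
proof -
  obtain p x q where s: "s = p @ x # q" "i = length p" using list_split_at1[OF assms] by metis
  show ?thesis
    by (cases x; cases b) (simp_all add: s cap_coeff_def A_pow_mult A_pow_mult_left slope_sign_def algebra_simps)
qed

lemma act_slide_cap:
  assumes "i + 3 \<le> length s"
  shows "act (Cross b (i + 1)) (act (Cap i) f) s = act (Cross (\<not> b) i) (act (Cap (i + 1)) f) s"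
proof -
  obtain p x y z q where s: "s = p @ x # y # z # q" "i = length p" using list_split_at3[OF assms] by metis
  show ?thesis
    by (cases x; cases y; cases z; cases b)
      (simp_all add: s cap_coeff_def A_pow_mult A_pow_mult_left slope_sign_def algebra_simps)
qed

text \<open>The familiar kink factor of the bracket. It is the only change of the state sum under a
  move, and the reason why invariance holds only up to units.\<close>

lemma act_reidemeister_1:
  assumes "i + 1 \<le> length s"
  shows "act (Cup (i + 1)) (act (Cross b i) (act (Cap (i + 1)) f)) s = - A_pow (3 * slope_sign b) * f s"
proof -
  obtain p x q where s: "s = p @ x # q" "i = length p" using list_split_at1[OF assms] by metis
  show ?thesis
    by (cases x; cases b) (simp_all add: s cap_coeff_def A_pow_mult A_pow_mult_left slope_sign_def algebra_simps)
qed

lemma act_reidemeister_2: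
  assumes "i + 2 \<le> length s"
  shows "act (Cross b i) (act (Cross (\<not> b) i) f) s = f s"
proof -
  obtain p x y q where s: "s = p @ x # y # q" "i = length p" using list_split_at2[OF assms] by metis
  show ?thesis
    by (cases x; cases y; cases b)
      (simp_all add: s cap_coeff_def A_pow_mult A_pow_mult_left slope_sign_def algebra_simps)
qed

lemma act_reidemeister_3:
  assumes "i + 3 \<le> length s"
  shows "act (Cross b i) (act (Cross b (i + 1)) (act (Cross b i) f)) s
    = act (Cross b (i + 1)) (act (Cross b i) (act (Cross b (i + 1)) f)) s"
proof -
  obtain p x y z q where s: "s = p @ x # y # z # q" "i = length p" using list_split_at3[OF assms] by metis
  show ?thesis
    by (cases x; cases y; cases z; cases b)
      (simp_all add: s cap_coeff_def A_pow_mult A_pow_mult_left slope_sign_def algebra_simps)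
qed


section \<open>The state sum and the number of loops\<close>

lemma Suc_sum_list_notin: "Suc (sum_list xs) \<notin> set (xs :: nat list)"
  using member_le_sum_list[of "Suc (sum_list xs)" xs] by auto

text \<open>Labels matter only through their equality pattern, but the label chosen at a minimum
  depends on their values, so the renaming has to be extended anew at every minimum.\<close>

lemma loops_rename:
  assumes "crossingless w" "tangle (length xs) w m" "inj_on g (set xs)"
  shows "loops w (map g xs) = loops w xs"
  using assms
proof (induction w xs arbitrary: g rule: loops.induct)
  case (2 i w xs)
  define f f' where "f = Suc (sum_list xs)" and "f' = Suc (sum_list (map g xs))"
  have fresh: "f \<notin> set xs" "f' \<notin> g ` set xs"
    using Suc_sum_list_notin[of xs] Suc_sum_list_notin[of "map g xs"] by (auto simp: f_def f'_def)
  define h where "h = g(f := f')"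
  have h: "map h xs = map g xs" using fresh by (auto simp: h_def)
  have "take i (map h xs) @ [f', f'] @ drop i (map h xs) = map h (take i xs @ [f, f] @ drop i xs)"
    by (simp add: h_def take_map drop_map)
  then have "take i (map g xs) @ [f', f'] @ drop i (map g xs) = map h (take i xs @ [f, f] @ drop i xs)"
    unfolding h .
  moreover have "set xs = set (take i xs) \<union> set (drop i xs)"
    by (metis append_take_drop_id set_append)
  then have "set (take i xs @ [f, f] @ drop i xs) = insert f (set xs)"
    by auto
  moreover have "inj_on h (insert f (set xs))"
    using fresh "2.prems"(3) by (auto simp: h_def inj_on_def)
  ultimately show ?case
    using "2.IH"[of h] "2.prems" by (simp add: f_def f'_def crossingless_def)
next
  case (3 i w xs)
  let ?a = "xs ! i" and ?b = "xs ! Suc i" and ?ys = "take i xs @ drop (i + 2) xs"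
  have i: "i + 2 \<le> length xs" using "3.prems" by simp
  then have ab: "map g xs ! i = g ?a" "map g xs ! Suc i = g ?b" "?a \<in> set xs" "?b \<in> set xs" by auto
  have ys: "set ?ys \<subseteq> set xs" by (auto dest: in_set_takeD in_set_dropD)
  have eq: "g ?a = g ?b \<longleftrightarrow> ?a = ?b" using "3.prems"(3) ab by (auto simp: inj_on_def)
  have m: "take i (map g xs) @ drop (i + 2) (map g xs) = map g ?ys" by (simp add: take_map drop_map)
  show ?case
  proof (cases "?a = ?b")
    case True
    have "loops w (map g ?ys) = loops w ?ys"
      using "3.IH"(1)[OF refl refl refl True, of g] "3.prems" i inj_on_subset[OF "3.prems"(3) ys]
      by (simp add: crossingless_def)
    then show ?thesis using True eq ab m i by (simp add: Let_def)
  next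
    case False
    let ?zs = "map (\<lambda>x. if x = ?a then ?b else x) ?ys"
    have "map (\<lambda>x. if x = g ?a then g ?b else x) (map g ?ys) = map g ?zs"
      using ys ab "3.prems"(3) by (auto simp: inj_on_def dest!: subsetD simp del: map_append set_append)
    moreover have "set ?zs \<subseteq> set xs"
      using ys ab by (auto simp del: map_append set_append)
    then have "loops w (map g ?zs) = loops w ?zs"
      using "3.IH"(2)[OF refl refl refl False, of g] "3.prems" i
      by (simp add: crossingless_def inj_on_subset[OF "3.prems"(3)] del: map_append set_append)
    ultimately have "loops w (map (\<lambda>x. if x = g ?a then g ?b else x) (map g ?ys)) = loops w ?zs"
      by (simp only:)
    then show ?thesis using False eq ab m i by (simp add: Let_def del: map_append map_map)
  qed
qed (auto simp: crossingless_def)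

text \<open>Needed when a minimum and a maximum are interchanged: the label lists before and after
  the maximum can have different sums, hence different fresh labels.\<close>

lemma loops_fresh:
  assumes "crossingless w" "tangle (length (p @ q) + 2) w m" "f \<notin> set (p @ q)" "f' \<notin> set (p @ q)"
  shows "loops w (p @ f # f # q) = loops w (p @ f' # f' # q)"
proof -
  have "p @ f' # f' # q = map (\<lambda>x. if x = f then f' else x) (p @ f # f # q)"
    using assms by (auto intro!: map_idI[symmetric])
  moreover have "inj_on (\<lambda>x. if x = f then f' else x) (set (p @ f # f # q))"
    using assms by (auto simp: inj_on_def)
  moreover have "tangle (length (p @ f # f # q)) w m" using assms(2) by simp
  ultimately show ?thesis
    using loops_rename[OF assms(1)] by metis
qed

lemma loops_prefix:
  assumes "crossingless u" "tangle (length xs) u n" "\<And>ys. length ys = n \<Longrightarrow> loops l ys = loops r ys"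
  shows "loops (u @ l) xs = loops (u @ r) xs"
  using assms
proof (induction u xs rule: loops.induct)
  case (3 i w xs)
  then show ?case by (auto simp: crossingless_def Let_def)
qed (auto simp: crossingless_def)

text \<open>The maximum replaces the label \<open>x\<close> of the old strand by the fresh one
  everywhere, which leaves a renaming of \<open>xs\<close>. In the mirror image the fresh label is
  replaced and \<open>xs\<close> itself returns.\<close>

lemma loops_straighten_left:
  assumes "crossingless v" "tangle (length xs) v m" "i + 1 \<le> length xs"
  shows "loops (Cup (i + 1) # Cap i # v) xs = loops v xs"
proof -
  obtain p x q where xs: "xs = p @ x # q" "i = length p" using list_split_at1[OF assms(3)] by metis
  define f where "f = Suc (sum_list xs)"
  have f: "f \<notin> set xs" unfolding f_def by (rule Suc_sum_list_notin)
  let ?m = "\<lambda>y. if y = x then f else y"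
  have "loops v (map ?m xs) = loops v xs"
    by (rule loops_rename[OF assms(1,2)]) (use f in \<open>auto simp: inj_on_def\<close>)
  then show ?thesis
    using f unfolding f_def xs by (simp add: Let_def nth_append cong: if_cong)
qed

lemma loops_straighten_right:
  assumes "i + 1 \<le> length xs"
  shows "loops (Cup i # Cap (i + 1) # v) xs = loops v xs"
proof -
  obtain p x q where xs: "xs = p @ x # q" "i = length p" using list_split_at1[OF assms] by metis
  define f where "f = Suc (sum_list xs)"
  have f: "f \<notin> set xs" unfolding f_def by (rule Suc_sum_list_notin)
  have "map (\<lambda>y. if y = f then x else y) (p @ f # q) = xs"
    using f by (auto simp: xs intro!: map_idI)
  then show ?thesis
    using f unfolding f_def xs by (simp add: Let_def nth_append cong: if_cong)
qed

lemma loops_far_left: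
  assumes "crossingless v" "tangle (length xs) v m" "i + 2 \<le> j" "j \<le> length xs"
  shows "loops (Cup j # Cap i # v) xs = loops (Cap i # Cup (j - 2) # v) xs"
proof -
  have "i + 2 \<le> length xs" using assms by simp
  then obtain p a b q0 where xs0: "xs = p @ a # b # q0" "i = length p" using list_split_at2 by metis
  define r q where "r = take (j - i - 2) q0" and "q = drop (j - i - 2) q0"
  have xs: "xs = p @ a # b # r @ q" and j: "j = length p + 2 + length r"
    using assms xs0 by (auto simp: r_def q_def)
  let ?f = "Suc (sum_list xs)"
  have f: "?f \<notin> set xs" by (rule Suc_sum_list_notin)
  show ?thesis
  proof (cases "a = b")
    case True
    have "loops v ((p @ r) @ ?f # ?f # q) = loops v ((p @ r) @ Suc (sum_list (p @ r @ q)) # Suc (sum_list (p @ r @ q)) # q)"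
      using f Suc_sum_list_notin[of "p @ r @ q"] assms xs
      by (intro loops_fresh) auto
    then show ?thesis using True xs0(2) j unfolding xs by (simp add: Let_def nth_append)
  next
    case False
    let ?m = "\<lambda>x. if x = a then b else x"
    let ?g = "Suc (sum_list (map ?m (p @ r @ q)))"
    have *: "x \<notin> set (map ?m p @ map ?m r @ map ?m q)" if "x \<notin> set xs" for x
      using that by (auto simp: xs)
    have "loops v ((map ?m (p @ r)) @ ?f # ?f # map ?m q) = loops v ((map ?m (p @ r)) @ ?g # ?g # map ?m q)"
      using *[OF f] Suc_sum_list_notin[of "map ?m (p @ r @ q)"] assms xs
      by (intro loops_fresh) auto
    moreover have "?f \<noteq> a" "?f \<noteq> b" using f by (auto simp: xs)
    ultimately show ?thesis using False xs0(2) j unfolding xs by (simp add: Let_def nth_append)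
  qed
qed

lemma loops_far_right:
  assumes "crossingless v" "tangle (length xs) v m" "j + 2 \<le> i" "i \<le> length xs"
  shows "loops (Cup j # Cap i # v) xs = loops (Cap (i - 2) # Cup j # v) xs"
proof -
  have "(i - 2) + 2 \<le> length xs" using assms by simp
  then obtain p0 a b q where xs0: "xs = p0 @ a # b # q" "i - 2 = length p0" using list_split_at2 by metis
  define p r where "p = take j p0" and "r = drop j p0"
  have xs: "xs = p @ r @ a # b # q" and j: "j = length p" and i: "i = length p + length r + 2"
    using assms xs0 by (auto simp: r_def p_def)
  let ?f = "Suc (sum_list xs)"
  have f: "?f \<notin> set xs" by (rule Suc_sum_list_notin)
  show ?thesis
  proof (cases "a = b")
    case True
    have "loops v (p @ ?f # ?f # r @ q) = loops v (p @ Suc (sum_list (p @ r @ q)) # Suc (sum_list (p @ r @ q)) # r @ q)"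
      using f Suc_sum_list_notin[of "p @ r @ q"] assms xs
      by (intro loops_fresh) auto
    then show ?thesis using True j i unfolding xs by (simp add: Let_def nth_append eval_nat_numeral)
  next
    case False
    let ?m = "\<lambda>x. if x = a then b else x"
    let ?g = "Suc (sum_list (map ?m (p @ r @ q)))"
    have *: "x \<notin> set (map ?m p @ map ?m r @ map ?m q)" if "x \<notin> set xs" for x
      using that by (auto simp: xs)
    have "loops v (map ?m p @ ?f # ?f # map ?m (r @ q)) = loops v (map ?m p @ ?g # ?g # map ?m (r @ q))"
      using *[OF f] Suc_sum_list_notin[of "map ?m (p @ r @ q)"] assms xs
      by (intro loops_fresh) auto
    moreover have "?f \<noteq> a" "?f \<noteq> b" using f by (auto simp: xs)
    ultimately show ?thesis using False j i unfolding xs by (simp add: Let_def nth_append eval_nat_numeral)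
  qed
qed

fun is_cup :: "slice \<Rightarrow> bool" where
  "is_cup (Cup i) = True"
| "is_cup _ = False"

lemma tangle_cups: "\<forall>t \<in> set u. is_cup t \<Longrightarrow> tangle n u m \<Longrightarrow> m = n + 2 * length u"
  by (induction n u m rule: tangle.induct) auto

text \<open>
  A closed crossingless diagram is emptied by moving its lowest maximum down until it meets a minimum.
\<close>

lemma acts_crossingless:
  assumes "crossingless w" "tangle 0 w 0"
  shows "acts w (\<lambda>_. 1) [] = loop_value ^ loops w []"
  using assms
\<comment> \<open>The measure is lexicographic: cancelling two slices shortens the diagram, while
  interchanging a minimum and a maximum keeps the length and shortens the initial block of
  minima.\<close>
proof (induction w rule: wf_induct_rule[OF wf_measures[of "[length, \<lambda>w. length (takeWhile is_cup w)]"]])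
  case (1 w)
  note cl = "1.prems"(1) and tw = "1.prems"(2) and IH = "1.IH"
  show ?case
  proof (cases "w = []")
    case False
    define u where "u = takeWhile is_cup w"
    have cups: "\<forall>t \<in> set u. is_cup t" by (auto simp: u_def dest: set_takeWhileD)
    \<comment> \<open>Minima only add strands, so a nonempty closed diagram contains another slice;
      the first such slice is a maximum with a minimum directly below it.\<close>
    have "\<not> (\<forall>t \<in> set w. is_cup t)"
      using tangle_cups[OF _ tw] False by auto
    then have "dropWhile is_cup w \<noteq> []" by (simp add: dropWhile_eq_Nil_conv)
    then obtain t v where tv: "dropWhile is_cup w = t # v" by (cases "dropWhile is_cup w") auto
    then have "\<not> is_cup t" using hd_dropWhile[of is_cup w] by simp
    have w: "w = u @ t # v" using tv takeWhile_dropWhile_id[of is_cup w] by (simp add: u_def)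
    obtain i where t: "t = Cap i" using \<open>\<not> is_cup t\<close> cl w by (cases t) (auto simp: crossingless_def)
    have "u \<noteq> []" using tw by (auto simp: w t)
    then obtain u' t' where "u = u' @ [t']" using rev_exhaust by blast
    moreover obtain j where "t' = Cup j" using cups calculation by (cases t') auto
    ultimately have u: "u = u' @ [Cup j]" by simp
    have w': "w = u' @ Cup j # Cap i # v" by (simp add: w u t)
    obtain n where n: "tangle 0 u' n" "j \<le> n" "i \<le> n" "tangle n v 0"
      using tw unfolding w' tangle_append by auto
    have clu: "crossingless u'" and clv: "crossingless v" using cl by (auto simp: w' crossingless_def)
    have short: "acts (u' @ v) (\<lambda>_. 1) [] = loop_value ^ loops (u' @ v) []"
      using IH[of "u' @ v"] clu clv n by (auto simp: w' crossingless_append tangle_append)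
    have far: "acts w (\<lambda>_. 1) [] = loop_value ^ loops w []"
      if eq: "\<And>ys. length ys = n \<Longrightarrow> loops (Cup j # Cap i # v) ys = loops (Cap i' # Cup j' # v) ys"
        and ij: "i' + 2 \<le> n" "j' \<le> n - 2"
        and ac: "\<And>s f. length s = n \<Longrightarrow> act (Cup j) (act (Cap i) f) s = act (Cap i') (act (Cup j') f) s" for i' j'
    proof -
      let ?w = "u' @ Cap i' # Cup j' # v"
      have "takeWhile is_cup ?w = u'"
        using cups by (auto simp: u takeWhile_append)
      then have "length (takeWhile is_cup ?w) < length (takeWhile is_cup w)"
        by (simp add: u flip: u_def)
      then have "acts ?w (\<lambda>_. 1) [] = loop_value ^ loops ?w []"
        using clu clv n ij
        by (intro IH) (auto simp: w' crossingless_def tangle_append numeral_eq_Suc Suc_diff_Suc intro!: exI[of _ n])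
      moreover have "loops w [] = loops ?w []"
        unfolding w' using n eq by (intro loops_prefix[OF clu, of _ n]) auto
      moreover have "acts w (\<lambda>_. 1) [] = acts ?w (\<lambda>_. 1) []"
        unfolding w' acts_append using n(1) ac by (intro acts_cong[of 0 u' n]) auto
      ultimately show ?thesis by simp
    qed
    consider "i = j" | "j = i + 1" | "i = j + 1" | "i + 2 \<le> j" | "j + 2 \<le> i" by linarith
    then show ?thesis
    proof cases
      case 1
      have "acts w (\<lambda>_. 1) [] = acts u' (\<lambda>s. loop_value * acts v (\<lambda>_. 1) s) []"
        unfolding w' 1 acts_append using n by (intro acts_cong[of 0 u' n]) (auto simp: act_circle)
      also have "\<dots> = loop_value * acts (u' @ v) (\<lambda>_. 1) []" by (simp add: acts_scale)
      also have "\<dots> = loop_value ^ loops w []"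
        using loops_circle[OF clu, of "[]" n i v] n short by (simp add: w' 1)
      finally show ?thesis .
    next
      case 2
      have "acts w (\<lambda>_. 1) [] = acts (u' @ v) (\<lambda>_. 1) []"
        unfolding w' 2 acts_append using n 2 by (intro acts_cong[of 0 u' n]) (auto simp: act_straighten_left[simplified])
      moreover have "loops w [] = loops (u' @ v) []"
        unfolding w' 2 using n 2 clv by (intro loops_prefix[OF clu, of _ n] loops_straighten_left) auto
      ultimately show ?thesis using short by simp
    next
      case 3
      have "acts w (\<lambda>_. 1) [] = acts (u' @ v) (\<lambda>_. 1) []"
        unfolding w' 3 acts_append using n 3 by (intro acts_cong[of 0 u' n]) (auto simp: act_straighten_right[simplified])
      moreover have "loops w [] = loops (u' @ v) []"
        unfolding w' 3 using n 3 clv by (intro loops_prefix[OF clu, of _ n] loops_straighten_right) auto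
      ultimately show ?thesis using short by simp
    next
      case 4
      show ?thesis
      proof (rule far[of i "j - 2"])
        fix ys :: "nat list" assume "length ys = n"
        then show "loops (Cup j # Cap i # v) ys = loops (Cap i # Cup (j - 2) # v) ys"
          using 4 n by (intro loops_far_left[OF clv]) auto
      next
        fix s :: "bool list" and f assume "length s = n"
        then show "act (Cup j) (act (Cap i) f) s = act (Cap i) (act (Cup (j - 2)) f) s"
          using act_far[of "Cap i" s "Cup (j - i - 2)" f] 4 n by (simp add: numeral_eq_Suc Suc_diff_Suc)
      qed (use 4 n in auto)
    next
      case 5
      show ?thesis
      proof (rule far[of "i - 2" j])
        fix ys :: "nat list" assume "length ys = n"
        then show "loops (Cup j # Cap i # v) ys = loops (Cap (i - 2) # Cup j # v) ys"
          using 5 n by (intro loops_far_right[OF clv]) auto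
      next
        fix s :: "bool list" and f assume "length s = n"
        then show "act (Cup j) (act (Cap i) f) s = act (Cap (i - 2)) (act (Cup j) f) s"
          using act_far[of "Cup j" s "Cap (i - j - 2)" f] 5 n by (simp add: numeral_eq_Suc Suc_diff_Suc)
      qed (use 5 n in auto)
    qed
  qed simp
qed


section \<open>Invariance of the bracket and the skein module\<close>

text \<open>The vertical arcs are the \<open>A\<close>-smoothing exactly when the overstrand has
  positive slope, whence the exponent \<open>slope_sign b\<close> in the crossing clause of
  \<open>act\<close>.\<close>

lemma act_Cross_smoothing:
  assumes "i + 2 \<le> length s"
  shows "act (Cross b i) f s = A_pow 1 * acts (map (shift i) (smoothing_A b)) f s
    + A_pow (- 1) * acts (map (shift i) (smoothing_B b)) f s"
proof -
  obtain p x y q where s: "s = p @ x # y # q" "i = length p" using list_split_at2[OF assms] by metis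
  show ?thesis
    by (cases b) (simp_all add: s smoothing_A_def smoothing_B_def tangle_0_def tangle_inf_def slope_sign_def)
qed

text \<open>The bracket gives a single circle the value 1, the state sum gives every circle
  \<open>loop_value\<close>; hence the extra factor. Nonemptiness guarantees a circle, without which
  \<open>loops u [] - 1\<close> would be truncated.\<close>

lemma loop_value_bracket_acc:
  assumes "crossingless u" "tangle 0 u n" "tangle n w 0" "u @ w \<noteq> []"
  shows "loop_value * bracket_acc u w = acts (u @ w) (\<lambda>_. 1) []"
  using assms
proof (induction u w arbitrary: n rule: bracket_acc.induct)
  case (1 u)
  then have "loops u [] > 0"
    using loops_pos[of u "[]"] by (simp add: paired_def)
  then have "loop_value * loop_value ^ (loops u [] - 1) = loop_value ^ loops u []"
    by (simp add: power_eq_if)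
  then show ?case using 1 acts_crossingless[of u] by simp
next
  case (2 u i w)
  then show ?case using "2.IH"[of "n + 2"] by (simp add: crossingless_def tangle_append)
next
  case (3 u i w)
  then show ?case using "3.IH"[of "n - 2"] by (auto simp: crossingless_def tangle_append)
next
  case (4 u b i w)
  then have i: "i + 2 \<le> n" "tangle n w 0" by auto
  then have w: "w \<noteq> []" by auto
  let ?A = "map (shift i) (smoothing_A b)" and ?B = "map (shift i) (smoothing_B b)"
  have tA: "tangle 0 (u @ ?A) n" and tB: "tangle 0 (u @ ?B) n"
    using "4.prems"(2) tangle_smoothing[OF i(1)] unfolding tangle_append by blast+
  have "acts (u @ Cross b i # w) (\<lambda>_. 1) []
    = acts u (\<lambda>s. A_pow 1 * acts ?A (acts w (\<lambda>_. 1)) s + A_pow (- 1) * acts ?B (acts w (\<lambda>_. 1)) s) []"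
    unfolding acts_append acts_Cons
    using "4.prems" i by (intro acts_cong[of 0 u n]) (auto simp: act_Cross_smoothing)
  also have "\<dots> = A_pow 1 * acts ((u @ ?A) @ w) (\<lambda>_. 1) [] + A_pow (- 1) * acts ((u @ ?B) @ w) (\<lambda>_. 1) []"
    by (simp add: acts_linear)
  also have "acts ((u @ ?A) @ w) (\<lambda>_. 1) [] = loop_value * bracket_acc (u @ ?A) w"
    using "4.IH"(1)[of n] "4.prems" i w tA by (simp add: crossingless_append crossingless_smoothing)
  also have "acts ((u @ ?B) @ w) (\<lambda>_. 1) [] = loop_value * bracket_acc (u @ ?B) w"
    using "4.IH"(2)[of n] "4.prems" i w tB by (simp add: crossingless_append crossingless_smoothing)
  finally show ?case by (simp add: algebra_simps)
qed

lemma loop_value_bracket: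
  assumes "link_diagram D"
  shows "loop_value * bracket D = acts D (\<lambda>_. 1) []"
  using assms loop_value_bracket_acc[of "[]" 0 D]
  by (simp add: link_diagram_def bracket_def crossingless_def)

text \<open>Laurent polynomials form an integral domain, so \<open>loop_value\<close> can be
  cancelled and identities of the state sum pass to the bracket.\<close>

lemma loop_value_nonzero: "loop_value \<noteq> 0"
proof
  assume "loop_value = 0"
  then have "Poly_Mapping.lookup loop_value 2 = 0" by simp
  then show False by (simp add: loop_value_def A_pow_def lookup_minus lookup_single)
qed

text \<open>The ambiguity of the bracket under isotopy. Such a factor shifts the exponents and
  possibly changes all signs, which affects neither the absence of cancellation nor that of
  gaps.\<close>

definition laurent_unit :: "laurent \<Rightarrow> bool" where
  "laurent_unit u \<longleftrightarrow> (\<exists>k. u = A_pow k \<or> u = - A_pow k)"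

lemma laurent_unit_1: "laurent_unit 1"
  unfolding laurent_unit_def by (metis A_pow_0)

lemma laurent_unit_A_pow: "laurent_unit (A_pow k)" "laurent_unit (- A_pow k)"
  by (auto simp: laurent_unit_def)

lemma laurent_unit_mult: "laurent_unit u \<Longrightarrow> laurent_unit v \<Longrightarrow> laurent_unit (u * v)"
  unfolding laurent_unit_def by (auto simp: A_pow_mult)

lemma laurent_unit_inverse:
  assumes "laurent_unit u" obtains v where "laurent_unit v" "v * u = 1"
proof -
  obtain k where "u = A_pow k \<or> u = - A_pow k" using assms by (auto simp: laurent_unit_def)
  then show thesis
    using that[of "A_pow (- k)"] that[of "- A_pow (- k)"] laurent_unit_A_pow by (auto simp: A_pow_mult)
qed

text \<open>The unit must not depend on \<open>f\<close> and \<open>s\<close>: only then can it be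
  pulled through the slices below the move by linearity.\<close>

lemma acts_move:
  assumes "planar_move l r \<or> reidemeister_move l r"
  obtains u where "laurent_unit u" "\<And>n m f s. tangle n l m \<Longrightarrow> length s = n \<Longrightarrow> acts l f s = u * acts r f s"
  using assms
proof (elim disjE)
  assume "planar_move l r"
  then have "acts l f s = 1 * acts r f s" if "tangle n l m" "length s = n" for n m f s
    using that
  proof cases
    case (far s' t)
    moreover have "pos s' + strands_in s' \<le> n" using that(1) by (cases s') (auto simp: far)
    ultimately show ?thesis using that(2) by (simp add: act_far)
  next
    case (slide_cup i b)
    then show ?thesis using that act_slide_cup[of i s b f] by simp
  next
    case (slide_cap b i)
    then show ?thesis using that act_slide_cap[of i s b f] by simp
  next
    case (straighten_left i)
    then show ?thesis using that act_straighten_left[of i s f] by simp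
  next
    case (straighten_right i)
    then show ?thesis using that act_straighten_right[of i s f] by simp
  qed
  then show thesis using that laurent_unit_1 by blast
next
  assume "reidemeister_move l r"
  then show thesis
  proof cases
    case (R1 i b)
    show thesis
    proof (rule that)
      show "laurent_unit (- A_pow (3 * slope_sign b))" by (rule laurent_unit_A_pow)
      fix n m f and s :: "bool list"
      assume "tangle n l m" "length s = n"
      then show "acts l f s = - A_pow (3 * slope_sign b) * acts r f s"
        using act_reidemeister_1[of i s b f] by (simp add: R1)
    qed
  next
    case (R2 b i)
    show thesis
    proof (rule that[OF laurent_unit_1])
      fix n m f and s :: "bool list"
      assume "tangle n l m" "length s = n"
      then show "acts l f s = 1 * acts r f s"
        using act_reidemeister_2[of i s b f] by (simp add: R2)
    qed
  next
    case (R3 b i)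
    show thesis
    proof (rule that[OF laurent_unit_1])
      fix n m f and s :: "bool list"
      assume "tangle n l m" "length s = n"
      then show "acts l f s = 1 * acts r f s"
        using act_reidemeister_3[of i s b f] by (simp add: R3)
    qed
  qed
qed

lemma bracket_step:
  assumes "diagram_step D E"
  obtains u where "laurent_unit u" "bracket D = u * bracket E"
proof -
  obtain x l r y where D: "D = x @ l @ y" "E = x @ r @ y" and m: "planar_move l r \<or> reidemeister_move l r"
    and ld: "link_diagram D" "link_diagram E"
    using assms by (auto simp: diagram_step_def)
  obtain n m where t: "tangle 0 x n" "tangle n l m" using ld(1) by (auto simp: D link_diagram_def tangle_append)
  obtain u where u: "laurent_unit u" "\<And>f s. length s = n \<Longrightarrow> acts l f s = u * acts r f s"
    using acts_move[OF m] t(2) by metis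
  have "loop_value * bracket D = acts x (\<lambda>s. u * acts r (acts y (\<lambda>_. 1)) s) []"
    unfolding loop_value_bracket[OF ld(1)] unfolding D acts_append
    using t u(2) by (intro acts_cong[of 0 x n]) auto
  also have "\<dots> = loop_value * (u * bracket E)"
    unfolding acts_scale using loop_value_bracket[OF ld(2)] by (simp add: D)
  finally show thesis using that[OF u(1)] loop_value_nonzero by simp
qed

lemma bracket_isotopic:
  assumes "isotopic D E"
  obtains u where "laurent_unit u" "bracket E = u * bracket D"
proof -
  have "equivclp diagram_step D E" using assms by (simp add: isotopic_def)
  then have "\<exists>u. laurent_unit u \<and> bracket E = u * bracket D"
  proof (induction rule: equivclp_induct)
    case base
    then show ?case using laurent_unit_1 by force
  next
    case (step E F)
    have "\<exists>v. laurent_unit v \<and> bracket F = v * bracket E"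
      using step.hyps(2)
    proof
      assume "diagram_step E F"
      then obtain u where u: "laurent_unit u" "bracket E = u * bracket F" by (rule bracket_step)
      then obtain v where "laurent_unit v" "v * u = 1" using laurent_unit_inverse by blast
      then show ?thesis using u by (metis mult.assoc mult_1)
    next
      assume "diagram_step F E"
      then show ?thesis by (metis bracket_step)
    qed
    then show ?case using step.IH laurent_unit_mult by (metis mult.assoc)
  qed
  then show thesis using that by blast
qed

section \<open>Skein expansions of tangles and their effect on the bracket\<close>

lemma tangle_shift: "tangle n w m \<Longrightarrow> tangle (i + n + k) (map (shift i) w) (i + m + k)"
proof (induction n w m rule: tangle.induct)
  case (3 n j w m)
  then have "i + (n - 2) + k = i + n + k - 2" by simp
  then show ?case using 3 by simp
qed (auto simp: algebra_simps)

text \<open>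
  \<open>skein \<tau> \<alpha> \<beta>\<close>: in the Kauffman bracket skein module of the disc with four marked points, the
  tangle \<open>\<tau>\<close> is \<open>\<alpha>\<close> times the tangle \<open>0\<close> plus \<open>\<beta>\<close> times the tangle \<open>\<infinity>\<close>.
\<close>

definition skein :: "diagram \<Rightarrow> laurent \<Rightarrow> laurent \<Rightarrow> bool" where
  "skein \<tau> \<alpha> \<beta> \<longleftrightarrow> tangle 2 \<tau> 2 \<and> (\<forall>i f s. i + 2 \<le> length s \<longrightarrow>
     acts (map (shift i) \<tau>) f s = \<alpha> * act (Cap i) (act (Cup i) f) s + \<beta> * f s)"

lemma skein_tangle_0: "skein tangle_0 1 0"
  by (simp add: skein_def tangle_0_def)

lemma skein_tangle_inf: "skein tangle_inf 0 1"
  by (simp add: skein_def tangle_inf_def)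

lemma skein_Cross: "skein [Cross b 0] (A_pow (- slope_sign b)) (A_pow (slope_sign b))"
proof -
  have "act (Cross b i) f s = A_pow (- slope_sign b) * act (Cap i) (act (Cup i) f) s + A_pow (slope_sign b) * f s"
    if i: "i + 2 \<le> length s" for i f s
  proof -
    obtain p x y q where s: "s = p @ x # y # q" "i = length p" using list_split_at2[OF i] by metis
    show ?thesis by (simp add: s)
  qed
  then show ?thesis by (simp add: skein_def)
qed

lemma act_Cap_Cup_cong:
  assumes "\<And>s'. length s' = length s \<Longrightarrow> f s' = g s'" "i + 2 \<le> length s"
  shows "act (Cap i) (act (Cup i) f) s = act (Cap i) (act (Cup i) g) s"
proof -
  have "tangle (length s) [Cap i, Cup i] (length s)" using assms(2) by auto
  from acts_cong[OF this, of f g s] assms(1) show ?thesis by simp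
qed

lemma act_Cap_Cup_linear:
  "act (Cap i) (act (Cup i) (\<lambda>s. a * f s + b * g s)) s
    = a * act (Cap i) (act (Cup i) f) s + b * act (Cap i) (act (Cup i) g) s"
  using acts_linear[of "[Cap i, Cup i]" a f b g] by (auto dest: fun_cong)

text \<open>For \<open>beside\<close>, the tangle \<open>tangle_0\<close> is neutral, and two copies
  of \<open>tangle_inf\<close> form one copy together with a closed circle; the rest is
  bilinearity.\<close>

lemma skein_beside:
  assumes "skein T \<alpha> \<beta>" "skein S \<alpha>' \<beta>'"
  shows "skein (beside T S) (\<alpha> * \<alpha>') (\<alpha> * \<beta>' + \<beta> * \<alpha>' + loop_value * \<beta> * \<beta>')"
  unfolding skein_def
proof (intro conjI allI impI)
  \<comment> \<open>Between the extra minimum and maximum there are four strands, two for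
    \<open>T\<close> and two for \<open>S\<close>. The shift by 0 serves to add the two idle strands
    on the right of \<open>T\<close>.\<close>
  have "tangle (0 + 2 + 2) (map (shift 0) T) (0 + 2 + 2)" "tangle (2 + 2 + 0) (map (shift 2) S) (2 + 2 + 0)"
    using assms by (auto simp only: skein_def intro!: tangle_shift)
  then have "tangle 4 (map (shift 0) T) 4" "tangle 4 (map (shift 2) S) 4"
    by (simp_all add: eval_nat_numeral)
  moreover have "map (shift 0) T = T" by (rule map_idI) (metis add_0 shift.elims)
  ultimately show "tangle 2 (beside T S) 2"
    by (auto simp: beside_def tangle_append intro!: exI[of _ 4])
next
  fix i f and s :: "bool list" assume i: "i + 2 \<le> length s"
  then obtain p x y q where s: "s = p @ x # y # q" "i = length p" using list_split_at2 by metis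
  define E where "E i f = act (Cap i) (act (Cup i) f)" for i f
  define h where "h = act (Cap (i + 1)) f"
  let ?TS = "acts (map (shift i) T) (acts (map (shift (i + 2)) S) h)"
  have "(shift i \<circ> shift 2) t = shift (i + 2) t" for t by (cases t) auto
  then have "map (shift i) (map (shift 2) S) = map (shift (i + 2)) S" by simp
  then have "acts (map (shift i) (beside T S)) f s = act (Cup (i + 1)) ?TS s"
    by (simp add: beside_def h_def del: map_map)
  also have "\<dots> = act (Cup (i + 1)) (\<lambda>s. \<alpha> * (\<alpha>' * E i (E (i + 2) h) s + \<beta>' * E i h s)
      + \<beta> * (\<alpha>' * E (i + 2) h s + \<beta>' * h s)) s"
  proof (rule act_cong[of "length s" _ "length s + 2"])
    fix s' :: "bool list" assume s': "length s' = length s + 2"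
    have S: "acts (map (shift (i + 2)) S) h s'' = \<alpha>' * E (i + 2) h s'' + \<beta>' * h s''"
      if "length s'' = length s'" for s''
      using assms(2) that s' i by (simp add: skein_def E_def)
    have "?TS s' = \<alpha> * E i (acts (map (shift (i + 2)) S) h) s' + \<beta> * acts (map (shift (i + 2)) S) h s'"
      using assms(1) s' i by (simp add: skein_def E_def)
    also have "E i (acts (map (shift (i + 2)) S) h) s' = E i (\<lambda>s. \<alpha>' * E (i + 2) h s + \<beta>' * h s) s'"
      unfolding E_def using S s' i by (intro act_Cap_Cup_cong) (auto simp: E_def)
    also have "\<dots> = \<alpha>' * E i (E (i + 2) h) s' + \<beta>' * E i h s'"
      unfolding E_def by (rule act_Cap_Cup_linear)
    finally show "?TS s' = \<alpha> * (\<alpha>' * E i (E (i + 2) h) s' + \<beta>' * E i h s')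
      + \<beta> * (\<alpha>' * E (i + 2) h s' + \<beta>' * h s')"
      using S by simp
  qed (use i in auto)
  also have "\<dots> = \<alpha> * \<alpha>' * act (Cup (i + 1)) (E i (E (i + 2) h)) s + \<alpha> * \<beta>' * act (Cup (i + 1)) (E i h) s
      + \<beta> * \<alpha>' * act (Cup (i + 1)) (E (i + 2) h) s + \<beta> * \<beta>' * act (Cup (i + 1)) h s"
    by (simp add: act.simps algebra_simps)
  also have "act (Cup (i + 1)) (E i (E (i + 2) h)) s = E i f s"
    unfolding E_def h_def s by (cases x; cases y) (simp_all add: cap_coeff_def A_pow_mult A_pow_mult_left algebra_simps)
  also have "act (Cup (i + 1)) (E i h) s = f s"
    unfolding E_def h_def s by (cases x; cases y) (simp_all add: cap_coeff_def A_pow_mult A_pow_mult_left algebra_simps)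
  also have "act (Cup (i + 1)) (E (i + 2) h) s = f s"
    unfolding E_def h_def s by (cases x; cases y) (simp_all add: cap_coeff_def A_pow_mult A_pow_mult_left algebra_simps)
  also have "act (Cup (i + 1)) h s = loop_value * f s"
    unfolding h_def using i by (intro act_circle) auto
  finally show "acts (map (shift i) (beside T S)) f s = \<alpha> * \<alpha>' * act (Cap i) (act (Cup i) f) s +
      (\<alpha> * \<beta>' + \<beta> * \<alpha>' + loop_value * \<beta> * \<beta>') * f s"
    by (simp add: E_def algebra_simps)
qed

text \<open>The quarter turn of the horizontal rule: now \<open>tangle_inf\<close> is neutral and
  two copies of \<open>tangle_0\<close> enclose a circle.\<close>

lemma skein_above:
  assumes "skein T \<alpha> \<beta>" "skein S \<alpha>' \<beta>'"
  shows "skein (above T S) (\<beta> * \<alpha>' + \<alpha> * \<beta>' + loop_value * \<alpha> * \<alpha>') (\<beta> * \<beta>')"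
  unfolding skein_def
proof (intro conjI allI impI)
  show "tangle 2 (above T S) 2"
    using assms by (auto simp: skein_def above_def tangle_append)
next
  fix i f and s :: "bool list" assume i: "i + 2 \<le> length s"
  then obtain p x y q where s: "s = p @ x # y # q" "i = length p" using list_split_at2 by metis
  define E where "E f = act (Cap i) (act (Cup i) f)" for f
  have T: "acts (map (shift i) T) f s' = \<alpha> * E f s' + \<beta> * f s'" if "length s' = length s" for s'
    using assms(1) that i by (simp add: skein_def E_def)
  have "acts (map (shift i) (above T S)) f s = \<alpha>' * E (acts (map (shift i) T) f) s + \<beta>' * acts (map (shift i) T) f s"
    using assms(2) i by (simp add: above_def skein_def E_def)
  also have "E (acts (map (shift i) T) f) s = E (\<lambda>s. \<alpha> * E f s + \<beta> * f s) s"
    unfolding E_def using T i by (intro act_Cap_Cup_cong) (auto simp: E_def)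
  also have "\<dots> = \<alpha> * E (E f) s + \<beta> * E f s"
    unfolding E_def by (rule act_Cap_Cup_linear)
  also have "E (E f) s = loop_value * E f s"
    unfolding E_def s by (simp add: loop_value_def cap_coeff_def A_pow_mult A_pow_mult_left algebra_simps)
  finally show "acts (map (shift i) (above T S)) f s = (\<beta> * \<alpha>' + \<alpha> * \<beta>' + loop_value * \<alpha> * \<alpha>') * act (Cap i) (act (Cup i) f) s +
      \<beta> * \<beta>' * f s"
    using T by (simp add: E_def algebra_simps)
qed

lemma link_diagram_replace:
  assumes "link_diagram D" "is_crossing D c" "tangle 2 \<tau> 2"
  shows "link_diagram (replace D c \<tau>)"
proof -
  obtain b i where c: "c < length D" "D ! c = Cross b i"
    using assms(2) by (auto simp: is_crossing_def)
  then have D: "D = take c D @ Cross b i # drop (c + 1) D"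
    by (metis id_take_nth_drop Suc_eq_plus1)
  obtain n where n: "tangle 0 (take c D) n" "i + 2 \<le> n" "tangle n (drop (c + 1) D) 0"
    using assms(1) tangle_append[of 0 "take c D" "Cross b i # drop (c + 1) D" 0] D
    by (auto simp: link_diagram_def)
  \<comment> \<open>There are \<open>n - i - 2\<close> strands to the right of the replaced
    crossing.\<close>
  have "i + 2 + (n - i - 2) = n" using n by simp
  then have "tangle n (map (shift i) \<tau>) n"
    using tangle_shift[OF assms(3), of i "n - i - 2"] by (simp only:)
  then have "tangle 0 (replace D c \<tau>) 0"
    using n c by (auto simp: replace_def tangle_append)
  moreover have "drop (c + 1) D \<noteq> []" using n by auto
  ultimately show ?thesis by (simp add: link_diagram_def replace_def)
qed

text \<open>The tangle enters the state sum only as an operator between the slices below and above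
  it, so its skein expansion passes to the whole diagram by linearity.\<close>

lemma bracket_replace:
  assumes "link_diagram D" "is_crossing D c" "skein \<tau> \<alpha> \<beta>"
  shows "bracket (replace D c \<tau>) = \<alpha> * bracket (replace D c tangle_0) + \<beta> * bracket (replace D c tangle_inf)"
proof -
  obtain b i where c: "c < length D" "D ! c = Cross b i"
    using assms(2) by (auto simp: is_crossing_def)
  then have D: "D = take c D @ Cross b i # drop (c + 1) D"
    by (metis id_take_nth_drop Suc_eq_plus1)
  let ?f = "acts (drop (c + 1) D) (\<lambda>_. 1)"
  obtain n where n: "tangle 0 (take c D) n" "i + 2 \<le> n"
    using assms(1) tangle_append[of 0 "take c D" "Cross b i # drop (c + 1) D" 0] D
    by (auto simp: link_diagram_def)
  have *: "loop_value * bracket (replace D c \<sigma>) = acts (take c D) (acts (map (shift i) \<sigma>) ?f) []"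
    if "skein \<sigma> \<gamma> \<delta>" for \<sigma> \<gamma> \<delta>
    using that loop_value_bracket[OF link_diagram_replace[OF assms(1,2)]] c by (simp add: skein_def replace_def)
  have "loop_value * bracket (replace D c \<tau>)
    = acts (take c D) (\<lambda>s. \<alpha> * acts (map (shift i) tangle_0) ?f s + \<beta> * acts (map (shift i) tangle_inf) ?f s) []"
    unfolding *[OF assms(3)]
    using n assms(3) by (intro acts_cong[of 0 _ n]) (auto simp: skein_def tangle_0_def tangle_inf_def)
  also have "\<dots> = loop_value * (\<alpha> * bracket (replace D c tangle_0) + \<beta> * bracket (replace D c tangle_inf))"
    unfolding acts_linear
    by (simp add: distrib_left mult.left_commute[of loop_value] *[OF skein_tangle_0] *[OF skein_tangle_inf])
  finally show ?thesis using loop_value_nonzero by simp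
qed


section \<open>Laurent polynomials without cancellation and without gaps\<close>

lemma lookup_single_mult:
  fixes P :: laurent
  shows "Poly_Mapping.lookup (Poly_Mapping.single k c * P) j = c * Poly_Mapping.lookup P (j - k)"
proof -
  have "Poly_Mapping.lookup (Poly_Mapping.single k c * P) j
      = Sum_any (\<lambda>l. Poly_Mapping.lookup (Poly_Mapping.single k c) l * Sum_any (\<lambda>q. Poly_Mapping.lookup P q when j = l + q))"
    by (simp add: lookup_mult)
  also have "(\<lambda>l. Poly_Mapping.lookup (Poly_Mapping.single k c) l * Sum_any (\<lambda>q. Poly_Mapping.lookup P q when j = l + q))
      = (\<lambda>l. (c * Sum_any (\<lambda>q. Poly_Mapping.lookup P q when j = l + q)) when k = l)"
    by (auto simp: lookup_single when_def)
  also have "Sum_any (\<lambda>l. (c * Sum_any (\<lambda>q. Poly_Mapping.lookup P q when j = l + q)) when k = l)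
      = c * Sum_any (\<lambda>q. Poly_Mapping.lookup P q when j = k + q)"
    by simp
  also have "(\<lambda>q. Poly_Mapping.lookup P q when j = k + q) = (\<lambda>q. Poly_Mapping.lookup P q when q = j - k)"
    by (auto simp: when_def)
  finally show ?thesis by simp
qed

lemma keys_single_mult:
  fixes P :: laurent
  assumes "c \<noteq> 0"
  shows "j \<in> Poly_Mapping.keys (Poly_Mapping.single k c * P) \<longleftrightarrow> j - k \<in> Poly_Mapping.keys P"
  using assms by (simp add: in_keys_iff lookup_single_mult)

lemma keys_A_pow_mult: "j \<in> Poly_Mapping.keys (A_pow k * P) \<longleftrightarrow> j - k \<in> Poly_Mapping.keys P"
  by (simp add: A_pow_def keys_single_mult)

lemma laurent_sum_monomials:
  fixes P :: laurent
  shows "(\<Sum>k\<in>Poly_Mapping.keys P. Poly_Mapping.single k (Poly_Mapping.lookup P k)) = P"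
  by (rule poly_mapping_eqI) (auto simp: lookup_sum lookup_single when_def in_keys_iff)

text \<open>
  The Laurent polynomials with coefficients in \<open>\<nat>\<close> times \<open>A\<^sup>r\<close> in the variable \<open>- A\<^sup>4\<close>, allowing \<open>r\<close>
  to be changed modulo 8.  They are exactly those whose terms do not cancel at a primitive eighth root of unity.
\<close>

definition cone :: "int \<Rightarrow> laurent \<Rightarrow> bool" where
  "cone r P \<longleftrightarrow> (\<forall>k \<in> Poly_Mapping.keys P. Poly_Mapping.lookup P k > 0 \<and> 8 dvd k - r
     \<or> Poly_Mapping.lookup P k < 0 \<and> 8 dvd k - r - 4)"

lemma cone_cong: "cone r P \<Longrightarrow> 8 dvd r - s \<Longrightarrow> cone s P"
proof -
  assume P: "cone r P" and rs: "8 dvd r - s"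
  have "8 dvd k - r \<Longrightarrow> 8 dvd k - s" "8 dvd k - r - 4 \<Longrightarrow> 8 dvd k - s - 4" for k
    using dvd_add[OF _ rs, of "k - r"] dvd_add[OF _ rs, of "k - r - 4"] by (simp_all add: algebra_simps)
  then show "cone s P" using P unfolding cone_def by blast
qed

lemma cone_1: "cone 0 1"
  by (simp add: cone_def)

lemma cone_cases:
  assumes "cone r P"
  shows "Poly_Mapping.lookup P k = 0 \<or> Poly_Mapping.lookup P k > 0 \<and> 8 dvd k - r
     \<or> Poly_Mapping.lookup P k < 0 \<and> 8 dvd k - r - 4"
  using assms by (auto simp: cone_def in_keys_iff)

lemma cone_keys: "cone r P \<Longrightarrow> k \<in> Poly_Mapping.keys P \<Longrightarrow> 4 dvd k - r"
proof -
  assume "cone r P" "k \<in> Poly_Mapping.keys P"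
  then have "8 dvd k - r \<or> 8 dvd k - r - 4" unfolding cone_def by blast
  moreover have "4 dvd j" if "8 dvd j \<or> 8 dvd j - 4" for j :: int using that by presburger
  ultimately show "4 dvd k - r" by blast
qed

text \<open>No exponent is congruent both to \<open>r\<close> and to \<open>r + 4\<close> modulo 8,
  so the coefficients of \<open>P\<close> and \<open>Q\<close> at one exponent never have opposite
  signs.\<close>

lemma
  assumes "cone r P" "cone r Q"
  shows cone_add: "cone r (P + Q)"
    and keys_cone_add: "Poly_Mapping.keys (P + Q) = Poly_Mapping.keys P \<union> Poly_Mapping.keys Q"
proof -
  have "\<not> (8 dvd k \<and> 8 dvd k - 4)" for k :: int by presburger
  then have "\<not> (8 dvd k - r \<and> 8 dvd k - r - 4)" for k by blast
  then have *: "Poly_Mapping.lookup P k \<ge> 0 \<and> Poly_Mapping.lookup Q k \<ge> 0 \<and> (8 dvd k - r \<or> Poly_Mapping.lookup P k = 0 \<and> Poly_Mapping.lookup Q k = 0)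
      \<or> Poly_Mapping.lookup P k \<le> 0 \<and> Poly_Mapping.lookup Q k \<le> 0 \<and> 8 dvd k - r - 4" for k
    using cone_cases[OF assms(1), of k] cone_cases[OF assms(2), of k] by fastforce
  show "Poly_Mapping.keys (P + Q) = Poly_Mapping.keys P \<union> Poly_Mapping.keys Q"
  proof (rule set_eqI)
    fix k
    show "k \<in> Poly_Mapping.keys (P + Q) \<longleftrightarrow> k \<in> Poly_Mapping.keys P \<union> Poly_Mapping.keys Q"
      using *[of k] by (simp add: in_keys_iff lookup_add) linarith
  qed
  show "cone r (P + Q)"
    unfolding cone_def
  proof
    fix k assume "k \<in> Poly_Mapping.keys (P + Q)"
    then show "0 < Poly_Mapping.lookup (P + Q) k \<and> 8 dvd k - r \<or> Poly_Mapping.lookup (P + Q) k < 0 \<and> 8 dvd k - r - 4"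
      using *[of k] by (simp add: in_keys_iff lookup_add) linarith
  qed
qed

lemma cone_sum:
  assumes "finite I" "\<And>i. i \<in> I \<Longrightarrow> cone r (f i)"
  shows "cone r (sum f I) \<and> Poly_Mapping.keys (sum f I) = (\<Union>i\<in>I. Poly_Mapping.keys (f i))"
  using assms
proof (induction I rule: finite_induct)
  case (insert x I)
  then show ?case using keys_cone_add[of r "f x" "sum f I"] by (simp add: cone_add)
qed (simp add: cone_def)

lemma cone_single_mult:
  assumes "c > 0 \<and> 8 dvd k - r \<or> c < 0 \<and> 8 dvd k - r - 4" "cone s Q"
  shows "cone (r + s) (Poly_Mapping.single k c * Q)"
  unfolding cone_def
proof
  fix j assume "j \<in> Poly_Mapping.keys (Poly_Mapping.single k c * Q)"
  then have "Poly_Mapping.lookup Q (j - k) \<noteq> 0" by (auto simp: in_keys_iff lookup_single_mult)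
  then have Q: "Poly_Mapping.lookup Q (j - k) > 0 \<and> 8 dvd j - k - s \<or> Poly_Mapping.lookup Q (j - k) < 0 \<and> 8 dvd j - k - s - 4"
    using cone_cases[OF assms(2), of "j - k"] by auto
  have dvd: "8 dvd j - (r + s)" if "8 dvd k - r" "8 dvd j - k - s"
    using dvd_add[OF that] by (simp add: algebra_simps)
  \<comment> \<open>Two negative coefficients: the offsets 4 and 4 add up to the full period 8, just
    as the signs cancel.\<close>
  have dvd': "8 dvd j - (r + s)" if "8 dvd k - r - 4" "8 dvd j - k - s - 4"
    using dvd_add[OF dvd_add[OF that], of 8] by (simp add: algebra_simps)
  have dvd'': "8 dvd j - (r + s) - 4" if "8 dvd k - r - 4" "8 dvd j - k - s"
    using dvd_add[OF that] by (simp add: algebra_simps)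
  have dvd''': "8 dvd j - (r + s) - 4" if "8 dvd k - r" "8 dvd j - k - s - 4"
    using dvd_add[OF that] by (simp add: algebra_simps)
  show "0 < Poly_Mapping.lookup (Poly_Mapping.single k c * Q) j \<and> 8 dvd j - (r + s) \<or>
      Poly_Mapping.lookup (Poly_Mapping.single k c * Q) j < 0 \<and> 8 dvd j - (r + s) - 4"
    unfolding lookup_single_mult
    using assms(1) Q dvd dvd' dvd'' dvd''' by (simp add: zero_less_mult_iff mult_less_0_iff) blast
qed

lemma cone_A_pow_mult: "cone r P \<Longrightarrow> cone (k + r) (A_pow k * P)"
  using cone_single_mult[of 1 k k r P] by (simp add: A_pow_def)

text \<open>For such \<open>k\<close> the factor is an odd power of \<open>- A^4\<close>.\<close>

lemma cone_minus_A_pow_mult: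
  assumes "cone r P" "8 dvd k + 4"
  shows "cone r (- A_pow k * P)"
proof -
  have "- A_pow k = Poly_Mapping.single k (- 1)" by (simp add: A_pow_def single_uminus)
  moreover have "8 dvd k - 0 - 4" using assms(2) by presburger
  ultimately show ?thesis using cone_single_mult[of "- 1" k 0 r P] assms(1) by simp
qed

text \<open>Splitting \<open>P\<close> into monomials makes the product a sum within one cone, where
  nothing cancels; in general the keys of a product are merely contained in the sumset.\<close>

lemma
  assumes "cone r P" "cone s Q"
  shows cone_mult: "cone (r + s) (P * Q)"
    and keys_cone_mult: "Poly_Mapping.keys (P * Q) = {x + y | x y. x \<in> Poly_Mapping.keys P \<and> y \<in> Poly_Mapping.keys Q}"
proof -
  let ?f = "\<lambda>k. Poly_Mapping.single k (Poly_Mapping.lookup P k) * Q"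
  have f: "cone (r + s) (?f k)" if "k \<in> Poly_Mapping.keys P" for k
    using that assms by (intro cone_single_mult) (auto simp: cone_def)
  have PQ: "P * Q = sum ?f (Poly_Mapping.keys P)"
    by (simp add: laurent_sum_monomials flip: sum_distrib_right)
  have sum: "cone (r + s) (P * Q) \<and> Poly_Mapping.keys (P * Q) = (\<Union>k\<in>Poly_Mapping.keys P. Poly_Mapping.keys (?f k))"
    unfolding PQ using f by (intro cone_sum) auto
  then show "cone (r + s) (P * Q)" ..
  have keys: "Poly_Mapping.keys (?f k) = {k + y | y. y \<in> Poly_Mapping.keys Q}" if "k \<in> Poly_Mapping.keys P" for k
  proof (rule set_eqI)
    fix j
    have "j \<in> Poly_Mapping.keys (?f k) \<longleftrightarrow> j - k \<in> Poly_Mapping.keys Q"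
      using that by (intro keys_single_mult) (simp add: in_keys_iff)
    also have "\<dots> \<longleftrightarrow> (\<exists>y. j = k + y \<and> y \<in> Poly_Mapping.keys Q)"
      by (metis add.commute add_diff_cancel_left' diff_add_cancel)
    finally show "j \<in> Poly_Mapping.keys (?f k) \<longleftrightarrow> j \<in> {k + y | y. y \<in> Poly_Mapping.keys Q}"
      by simp
  qed
  have "Poly_Mapping.keys (P * Q) = (\<Union>k\<in>Poly_Mapping.keys P. {k + y | y. y \<in> Poly_Mapping.keys Q})"
    using sum keys by simp
  then show "Poly_Mapping.keys (P * Q) = {x + y | x y. x \<in> Poly_Mapping.keys P \<and> y \<in> Poly_Mapping.keys Q}"
    by blast
qed

text \<open>A step of 4 in the exponent of \<open>A\<close> is a step of 1 in that of
  \<open>t\<close>. The set may meet several classes modulo 4; that it lies in a single one is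
  supplied separately by \<open>cone\<close>.\<close>

definition gapfree :: "int set \<Rightarrow> bool" where
  "gapfree S \<longleftrightarrow> S \<noteq> {} \<and> (\<forall>x \<in> S. \<forall>y \<in> S. \<forall>w. x \<le> w \<and> w \<le> y \<and> 4 dvd w - x \<longrightarrow> w \<in> S)"

lemma gapfreeD: "gapfree S \<Longrightarrow> x \<in> S \<Longrightarrow> y \<in> S \<Longrightarrow> x \<le> w \<Longrightarrow> w \<le> y \<Longrightarrow> 4 dvd w - x \<Longrightarrow> w \<in> S"
  unfolding gapfree_def by blast

lemma gapfree_between:
  assumes "gapfree S" "x \<in> S" "y \<in> S" "4 dvd x - y" "4 dvd w - x" "x \<le> w \<and> w \<le> y \<or> y \<le> w \<and> w \<le> x"
  shows "w \<in> S"
proof -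
  have "4 dvd w - y" using dvd_add[OF assms(4,5)] by simp
  then show ?thesis using assms gapfreeD by blast
qed

lemma gapfree_shift: "gapfree S \<Longrightarrow> gapfree {x. x - k \<in> S}"
  unfolding gapfree_def
proof (elim conjE, intro conjI ballI allI impI)
  assume "S \<noteq> {}"
  then obtain x where "x \<in> S" by blast
  then have "x + k \<in> {x. x - k \<in> S}" by simp
  then show "{x. x - k \<in> S} \<noteq> {}" by blast
next
  fix x y w assume S: "\<forall>x\<in>S. \<forall>y\<in>S. \<forall>w. x \<le> w \<and> w \<le> y \<and> 4 dvd w - x \<longrightarrow> w \<in> S"
    and x: "x \<in> {x. x - k \<in> S}" and y: "y \<in> {x. x - k \<in> S}" and w: "x \<le> w \<and> w \<le> y \<and> 4 dvd w - x"
  have "w - k \<in> S"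
    using S[rule_format, of "x - k" "y - k" "w - k"] x y w by simp
  then show "w \<in> {x. x - k \<in> S}" by simp
qed

lemma gapfree_A_pow_mult: "gapfree (Poly_Mapping.keys P) \<Longrightarrow> gapfree (Poly_Mapping.keys (A_pow k * P))"
proof -
  assume "gapfree (Poly_Mapping.keys P)"
  from gapfree_shift[OF this, of k] show ?thesis by (simp add: keys_A_pow_mult[symmetric])
qed

text \<open>
  Every element of the union \<open>U\<close> is joined within \<open>U\<close>, in steps of 4, to an element of \<open>p + (Z \<union> N)\<close>,
  which is itself contained in \<open>U\<close>.
\<close>

lemma gapfree_sumset_Un:
  assumes F: "gapfree F" and G: "gapfree G" and p: "p \<in> F" "p \<in> G" and ZN: "gapfree (Z \<union> N)"
    and r: "\<And>x. x \<in> F \<union> G \<Longrightarrow> 4 dvd x - r" and q: "\<And>x. x \<in> Z \<union> N \<Longrightarrow> 4 dvd x - q"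
  defines "U \<equiv> {x + y | x y. x \<in> F \<and> y \<in> Z} \<union> {x + y | x y. x \<in> G \<and> y \<in> N}"
  shows "gapfree U"
proof -
  have U_F: "x + y \<in> U" if "x \<in> F" "y \<in> Z" for x y using that by (auto simp: U_def)
  have U_G: "x + y \<in> U" if "x \<in> G" "y \<in> N" for x y using that by (auto simp: U_def)
  have link: "\<exists>t \<in> Z \<union> N. 4 dvd s - (p + t) \<and>
      (\<forall>w. 4 dvd w - s \<longrightarrow> s \<le> w \<and> w \<le> p + t \<or> p + t \<le> w \<and> w \<le> s \<longrightarrow> w \<in> U)" if s_U: "s \<in> U" for s
  proof -
    obtain x t where s: "s = x + t" and xt: "x \<in> F \<and> t \<in> Z \<or> x \<in> G \<and> t \<in> N"
      using s_U by (auto simp: U_def)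
    have "4 dvd x - r" "4 dvd p - r" using r xt p by auto
    then have xp: "4 dvd x - p" using dvd_diff[of 4 "x - r" "p - r"] by simp
    have "w \<in> U" if "4 dvd w - s" "s \<le> w \<and> w \<le> p + t \<or> p + t \<le> w \<and> w \<le> s" for w
    proof -
      have w: "4 dvd (w - t) - x" "x \<le> w - t \<and> w - t \<le> p \<or> p \<le> w - t \<and> w - t \<le> x"
        using that unfolding s by (simp add: algebra_simps, linarith)
      show ?thesis
        using xt
      proof
        assume "x \<in> F \<and> t \<in> Z"
        then show "w \<in> U" using gapfree_between[OF F _ p(1) xp w] U_F[of "w - t" t] by simp
      next
        assume "x \<in> G \<and> t \<in> N"
        then show "w \<in> U" using gapfree_between[OF G _ p(2) xp w] U_G[of "w - t" t] by simp
      qed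
    qed
    moreover have "4 dvd s - (p + t)" using xp by (simp add: s)
    ultimately show ?thesis using xt by blast
  qed
  \<comment> \<open>Here \<open>p\<close> has to lie in both \<open>F\<close> and \<open>G\<close>:
    whether \<open>w - p\<close> comes from \<open>Z\<close> or from \<open>N\<close>, its translate
    by \<open>p\<close> is in \<open>U\<close>.\<close>
  have middle: "w \<in> U" if "t \<in> Z \<union> N" "t' \<in> Z \<union> N" "4 dvd w - (p + t)" "p + t \<le> w" "w \<le> p + t'" for t t' w
  proof -
    have "w - p \<in> Z \<union> N"
      using gapfreeD[OF ZN that(1,2), of "w - p"] that(3-5) by (simp add: algebra_simps)
    then show ?thesis using U_F[OF p(1), of "w - p"] U_G[OF p(2), of "w - p"] by auto
  qed
  have "w \<in> U" if x: "x \<in> U" and y: "y \<in> U" and w: "x \<le> w" "w \<le> y" "4 dvd w - x" for x y w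
  proof -
    obtain t where t: "t \<in> Z \<union> N" "4 dvd x - (p + t)"
      "\<And>w. 4 dvd w - x \<Longrightarrow> x \<le> w \<and> w \<le> p + t \<or> p + t \<le> w \<and> w \<le> x \<Longrightarrow> w \<in> U"
      using link[OF x] by blast
    obtain t' where t': "t' \<in> Z \<union> N" "4 dvd y - (p + t')"
      "\<And>w. 4 dvd w - y \<Longrightarrow> y \<le> w \<and> w \<le> p + t' \<or> p + t' \<le> w \<and> w \<le> y \<Longrightarrow> w \<in> U"
      using link[OF y] by blast
    \<comment> \<open>As \<open>Z \<union> N\<close> lies in one class modulo 4, the stretches from
      \<open>x\<close> to \<open>p + t\<close>, on to \<open>p + t'\<close> and on to
      \<open>y\<close> all run through the same residue class.\<close>
    have "4 dvd t - q" "4 dvd t' - q" using t(1) t'(1) q by auto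
    then have "4 dvd t - t'" using dvd_diff[of 4 "t - q" "t' - q"] by simp
    moreover have d: "4 dvd w - (p + t)" using dvd_add[OF w(3) t(2)] by (simp add: algebra_simps)
    ultimately have d': "4 dvd w - y"
      using dvd_diff[OF dvd_add[OF d] t'(2), of "t - t'"] by (simp add: algebra_simps)
    consider "w \<le> p + t" | "p + t \<le> w" "w \<le> p + t'" | "p + t' \<le> w" by linarith
    then show ?thesis
    proof cases
      case 1 then show ?thesis using t(3)[of w] w by simp
    next
      case 2 then show ?thesis using middle[OF t(1) t'(1) d] by simp
    next
      case 3 then show ?thesis using t'(3)[of w] d' w by simp
    qed
  qed
  moreover have "U \<noteq> {}"
    using p ZN unfolding U_def gapfree_def by blast
  ultimately show ?thesis unfolding gapfree_def by blast
qed

text \<open>Without cancellation, \<open>keys\<close> turns products into sumsets and sums into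
  unions, so only sets of integers remain.\<close>

lemma gapfree_keys_combination:
  assumes "cone r F" "cone r G" "cone q Z" "cone q N"
    and "gapfree (Poly_Mapping.keys F)" "gapfree (Poly_Mapping.keys G)"
    and "Poly_Mapping.keys F \<inter> Poly_Mapping.keys G \<noteq> {}" "gapfree (Poly_Mapping.keys (Z + N))"
  shows "gapfree (Poly_Mapping.keys (F * Z + G * N))"
proof -
  obtain p where p: "p \<in> Poly_Mapping.keys F" "p \<in> Poly_Mapping.keys G" using assms(7) by blast
  have "gapfree (Poly_Mapping.keys Z \<union> Poly_Mapping.keys N)"
    using assms(8) keys_cone_add[OF assms(3,4)] by simp
  then have "gapfree ({x + y | x y. x \<in> Poly_Mapping.keys F \<and> y \<in> Poly_Mapping.keys Z} \<union>
      {x + y | x y. x \<in> Poly_Mapping.keys G \<and> y \<in> Poly_Mapping.keys N})"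
    using assms(1-4) by (intro gapfree_sumset_Un[OF assms(5,6) p, where r = r and q = q]) (blast dest: cone_keys)+
  moreover have "Poly_Mapping.keys (F * Z + G * N) = Poly_Mapping.keys (F * Z) \<union> Poly_Mapping.keys (G * N)"
    by (rule keys_cone_add[OF cone_mult[OF assms(1,3)] cone_mult[OF assms(2,4)]])
  ultimately show ?thesis
    by (simp only: keys_cone_mult[OF assms(1,3)] keys_cone_mult[OF assms(2,4)])
qed

text \<open>
  For \<open>B = A\<^sup>e\<close>, a tangle \<open>\<tau>\<close> with \<open>skein \<tau> (B\<^sup>-\<^sup>1 F) (B G)\<close> is described by the pair \<open>F\<close>, \<open>G\<close>; a crossing
  of type \<open>e\<close> has \<open>F = G = 1\<close>.  Both \<open>F\<close> and \<open>H = F - (1 + B\<^sup>4) G\<close> are multiplicative under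
  \<open>beside\<close>, up to units.  For \<open>above\<close> the roles of \<open>F\<close> and \<open>G\<close> are swapped and \<open>e\<close> changes sign.
\<close>

definition good :: "int \<Rightarrow> int \<Rightarrow> laurent \<Rightarrow> laurent \<Rightarrow> bool" where
  "good e r F G \<longleftrightarrow> cone r F \<and> cone r G \<and> cone r (F - G - A_pow (4 * e) * G) \<and>
     gapfree (Poly_Mapping.keys F) \<and> gapfree (Poly_Mapping.keys G) \<and>
     Poly_Mapping.keys F \<inter> Poly_Mapping.keys G \<noteq> {}"

lemma good_1: "e = 1 \<or> e = - 1 \<Longrightarrow> good e 0 1 1"
proof -
  assume "e = 1 \<or> e = - 1"
  then have "8 dvd 4 * e + 4" by auto
  then have "cone 0 (- A_pow (4 * e) * 1)" by (intro cone_minus_A_pow_mult cone_1)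
  then show ?thesis by (simp add: good_def cone_1 gapfree_def)
qed

text \<open>Up to a unit this is the new \<open>G\<close> after adding one crossing by
  \<open>beside\<close>; it also equals \<open>G + H\<close>. It is a combination with
  \<open>Z = 1\<close> and \<open>N = - A_pow (4 * e)\<close>, whose joint support
  \<open>{0, 4 * e}\<close> has no gap.\<close>

lemma gapfree_keys_horizontal:
  assumes "e = 1 \<or> e = - 1" "good e r F G"
  shows "gapfree (Poly_Mapping.keys (F - A_pow (4 * e) * G))"
proof -
  have e: "8 dvd 4 * e + 4" using assms(1) by auto
  note g = assms(2)[unfolded good_def]
  have c: "cone 0 (- A_pow (4 * e))" using cone_minus_A_pow_mult[OF cone_1 e] by simp
  have "Poly_Mapping.keys (- A_pow (4 * e)) = {4 * e}"
    by (simp add: A_pow_def)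
  then have "Poly_Mapping.keys (1 + - A_pow (4 * e)) = {0, 4 * e}"
    using keys_cone_add[OF cone_1 c] by (simp add: insert_commute)
  moreover have "gapfree {0, 4 * e}"
  proof -
    have "w \<in> {0, 4 * e}" if "x \<in> {0, 4 * e}" "y \<in> {0, 4 * e}" "x \<le> w" "w \<le> y" and d: "4 dvd w - x" for x y w
    proof -
      obtain k where "w - x = 4 * k" using d by blast
      then have "w = x + 4 * k" by simp
      then show ?thesis using assms(1) that(1-4) by (elim disjE) auto
    qed
    then show ?thesis unfolding gapfree_def by blast
  qed
  ultimately have "gapfree (Poly_Mapping.keys (F * 1 + G * (- A_pow (4 * e))))"
    using g c cone_1 by (intro gapfree_keys_combination[of r _ _ 0]) auto
  then show ?thesis by (simp add: mult.commute)
qed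


section \<open>Products of rational tangles\<close>

lemma good_beside:
  assumes "e = 1 \<or> e = - 1" "good e r F G" "good e r' F' G'"
  shows "good e (- e + (r + r')) (A_pow (- e) * (F * F'))
    (A_pow (- e) * (F * G' + G * F' - G * G' - A_pow (4 * e) * (G * G')))"
proof -
  define x where "x = A_pow (4 * e)"
  define H H' where "H = F - G - x * G" and "H' = F' - G' - x * G'"
  have g: "cone r F" "cone r G" "cone r H" "gapfree (Poly_Mapping.keys F)" "gapfree (Poly_Mapping.keys G)"
      "Poly_Mapping.keys F \<inter> Poly_Mapping.keys G \<noteq> {}"
    and g': "cone r' F'" "cone r' G'" "cone r' H'" "gapfree (Poly_Mapping.keys F')" "gapfree (Poly_Mapping.keys G')"
      "Poly_Mapping.keys F' \<inter> Poly_Mapping.keys G' \<noteq> {}"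
    using assms by (auto simp: good_def H_def H'_def x_def)
  \<comment> \<open>Introducing \<open>H'\<close> absorbs the negative terms: both remaining
    products lie in one cone.\<close>
  have G'': "F * G' + G * F' - G * G' - x * (G * G') = F * G' + G * H'"
    by (simp add: H'_def algebra_simps)
  have H'': "F * F' - (F * G' + G * H') - x * (F * G' + G * H') = H * H'"
    by (simp add: H_def H'_def algebra_simps)
  have "gapfree (Poly_Mapping.keys (G' + H'))"
    using gapfree_keys_horizontal(1)[OF assms(1,3)] by (simp add: H'_def x_def)
  then have gap: "gapfree (Poly_Mapping.keys (F * G' + G * H'))"
    by (rule gapfree_keys_combination[OF g(1,2) g'(2,3) g(4-6)])
  \<comment> \<open>A single product is treated as a combination with \<open>Z = N = F'\<close>,
    since doubling a polynomial leaves its keys unchanged.\<close>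
  have "Poly_Mapping.keys F \<inter> Poly_Mapping.keys F \<noteq> {}" "gapfree (Poly_Mapping.keys (F' + F'))"
    using g(6) g'(4) keys_cone_add[OF g'(1) g'(1)] by auto
  then have "gapfree (Poly_Mapping.keys (F * F' + F * F'))"
    by (intro gapfree_keys_combination[OF g(1,1) g'(1,1) g(4,4)])
  then have gapF: "gapfree (Poly_Mapping.keys (F * F'))"
    using keys_cone_add[OF cone_mult[OF g(1) g'(1)] cone_mult[OF g(1) g'(1)]] by simp
  have keysG: "Poly_Mapping.keys (F * G' + G * H') = Poly_Mapping.keys (F * G') \<union> Poly_Mapping.keys (G * H')"
    by (rule keys_cone_add[OF cone_mult[OF g(1) g'(2)] cone_mult[OF g(2) g'(3)]])
  obtain p p' where p: "p \<in> Poly_Mapping.keys F" and p': "p' \<in> Poly_Mapping.keys F'" "p' \<in> Poly_Mapping.keys G'"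
    using g(6) g'(6) by blast
  have "p + p' \<in> Poly_Mapping.keys (F * F')" "p + p' \<in> Poly_Mapping.keys (F * G' + G * H')"
    using p p' by (auto simp: keysG keys_cone_mult[OF g(1) g'(1)] keys_cone_mult[OF g(1) g'(2)])
  then have "p + p' - e \<in> Poly_Mapping.keys (A_pow (- e) * (F * F')) \<inter> Poly_Mapping.keys (A_pow (- e) * (F * G' + G * H'))"
    by (simp add: keys_A_pow_mult)
  moreover have "A_pow (- e) * (F * F') - A_pow (- e) * (F * G' + G * H') - x * (A_pow (- e) * (F * G' + G * H')) = A_pow (- e) * (H * H')"
    unfolding H''[symmetric] by (simp add: algebra_simps)
  moreover have "cone (- e + (r + r')) (A_pow (- e) * (F * F'))" "cone (- e + (r + r')) (A_pow (- e) * (H * H'))"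
      "cone (- e + (r + r')) (A_pow (- e) * (F * G' + G * H'))"
    by (rule cone_A_pow_mult cone_add cone_mult g g')+
  ultimately show ?thesis
    unfolding good_def x_def[symmetric] G'' using gap gapF by (simp add: gapfree_A_pow_mult) blast
qed

text \<open>A rational tangle is twisted alternately in both directions, so the condition is carried
  along together with its quarter turn. A row of tangles needs only the version for its own
  direction.\<close>

definition rational_good :: "int \<Rightarrow> int \<Rightarrow> laurent \<Rightarrow> laurent \<Rightarrow> bool" where
  "rational_good e r F G \<longleftrightarrow> good e r F G \<and> good (- e) r G F"

lemma rational_good_swap: "rational_good (- e) r G F \<longleftrightarrow> rational_good e r F G"
  by (auto simp: rational_good_def)

lemma rational_good_1: "e = 1 \<or> e = - 1 \<Longrightarrow> rational_good e 0 1 1"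
  by (auto simp: rational_good_def intro: good_1)

text \<open>The first half is a product with a crossing, where \<open>F' = G' = 1\<close>. In the
  third polynomial of the turned half the two terms \<open>F\<close> cancel; up to a unit, odd
  powers of \<open>- A^4\<close> times \<open>F\<close> and \<open>G\<close> remain.\<close>

lemma rational_good_beside:
  assumes "e = 1 \<or> e = - 1" "rational_good e r F G"
  shows "rational_good e (- e + r) (A_pow (- e) * F) (A_pow (- e) * (F - A_pow (4 * e) * G))"
proof -
  have e: "8 dvd 4 * e + 4" "8 dvd 4 * (- e) + 4" using assms(1) by auto
  have g: "good e r F G" "cone r F" "cone r G" using assms(2) by (auto simp: rational_good_def good_def)
  let ?F = "A_pow (- e) * F" and ?G = "A_pow (- e) * (F - A_pow (4 * e) * G)"
  have 1: "good e (- e + r) ?F ?G"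
    using good_beside[OF assms(1) g(1) good_1[OF assms(1)]] by simp
  have "?G - ?F - A_pow (4 * (- e)) * ?F = A_pow (- e) * (- A_pow (4 * e) * G + - A_pow (4 * (- e)) * F)"
    by (simp add: algebra_simps)
  moreover have "cone (- e + r) (A_pow (- e) * (- A_pow (4 * e) * G + - A_pow (4 * (- e)) * F))"
    using g e by (intro cone_A_pow_mult cone_add cone_minus_A_pow_mult)
  ultimately show ?thesis
    using 1 by (auto simp: rational_good_def good_def)
qed

lemma rational_good_above:
  assumes "e = 1 \<or> e = - 1" "rational_good e r F G"
  shows "rational_good e (e + r) (A_pow e * (G - A_pow (- 4 * e) * F)) (A_pow e * G)"
proof -
  have "- e = 1 \<or> - e = - 1" using assms(1) by auto
  moreover have "rational_good (- e) r G F" using assms(2) by (rule rational_good_swap[THEN iffD2])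
  ultimately have "rational_good (- e) (e + r) (A_pow e * G) (A_pow e * (G - A_pow (- 4 * e) * F))"
    using rational_good_beside[of "- e" r G F] by simp
  then show ?thesis by (rule rational_good_swap[THEN iffD1])
qed

definition tangle_pair :: "int \<Rightarrow> diagram \<Rightarrow> laurent \<Rightarrow> laurent \<Rightarrow> bool" where
  "tangle_pair e \<tau> F G \<longleftrightarrow> skein \<tau> (A_pow (- e) * F) (A_pow e * G)"

lemma tangle_pair_Cross: "tangle_pair (slope_sign b) [Cross b 0] 1 1"
  using skein_Cross[of b] by (simp add: tangle_pair_def)

lemma loop_value_A_pow: "e = 1 \<or> e = - 1 \<Longrightarrow> loop_value = - A_pow (- 2 * e) - A_pow (2 * e)"
  by (auto simp: loop_value_def)

lemma tangle_pair_beside: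
  assumes "e = 1 \<or> e = - 1" "tangle_pair e T F G" "tangle_pair e S F' G'"
  shows "tangle_pair e (beside T S) (A_pow (- e) * (F * F'))
    (A_pow (- e) * (F * G' + G * F' - G * G' - A_pow (4 * e) * (G * G')))"
proof -
  have "skein (beside T S) (A_pow (- e) * F * (A_pow (- e) * F'))
      (A_pow (- e) * F * (A_pow e * G') + A_pow e * G * (A_pow (- e) * F')
        + loop_value * (A_pow e * G) * (A_pow e * G'))"
    using assms(2,3) unfolding tangle_pair_def by (rule skein_beside)
  moreover have "A_pow (- e) * F * (A_pow e * G') + A_pow e * G * (A_pow (- e) * F')
        + loop_value * (A_pow e * G) * (A_pow e * G')
      = A_pow e * (A_pow (- e) * (F * G' + G * F' - G * G' - A_pow (4 * e) * (G * G')))"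
    unfolding loop_value_A_pow[OF assms(1)]
    by (simp add: algebra_simps A_pow_mult A_pow_mult_left)
  ultimately show ?thesis
    by (simp add: tangle_pair_def mult_ac)
qed

lemma tangle_pair_above:
  assumes "e = 1 \<or> e = - 1" "tangle_pair e T F G" "tangle_pair e S F' G'"
  shows "tangle_pair e (above T S) (A_pow e * (G * F' + F * G' - F * F' - A_pow (- 4 * e) * (F * F')))
    (A_pow e * (G * G'))"
proof -
  have "skein (above T S) (A_pow e * G * (A_pow (- e) * F') + A_pow (- e) * F * (A_pow e * G')
        + loop_value * (A_pow (- e) * F) * (A_pow (- e) * F')) (A_pow e * G * (A_pow e * G'))"
    using assms(2,3) unfolding tangle_pair_def by (rule skein_above)
  moreover have "A_pow e * G * (A_pow (- e) * F') + A_pow (- e) * F * (A_pow e * G')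
        + loop_value * (A_pow (- e) * F) * (A_pow (- e) * F')
      = A_pow (- e) * (A_pow e * (G * F' + F * G' - F * F' - A_pow (- 4 * e) * (F * F')))"
    unfolding loop_value_A_pow[OF assms(1)]
    by (simp add: algebra_simps A_pow_mult A_pow_mult_left)
  ultimately show ?thesis
    by (simp add: tangle_pair_def mult_ac)
qed

lemma slope_sign_cases: "slope_sign b = 1 \<or> slope_sign b = - 1"
  by (simp add: slope_sign_def)

definition rational_value :: "int \<Rightarrow> diagram \<Rightarrow> bool" where
  "rational_value e \<tau> \<longleftrightarrow> (\<exists>r F G. tangle_pair e \<tau> F G \<and> rational_good e r F G)"

lemma rational_value_step:
  assumes "rational_value (slope_sign b) T"
  shows "rational_value (slope_sign b) (if h then beside T [Cross b 0] else above T [Cross b 0])"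
proof -
  obtain r F G where T: "tangle_pair (slope_sign b) T F G" "rational_good (slope_sign b) r F G"
    using assms by (auto simp: rational_value_def)
  show ?thesis
    using tangle_pair_beside[OF slope_sign_cases T(1) tangle_pair_Cross]
      tangle_pair_above[OF slope_sign_cases T(1) tangle_pair_Cross]
      rational_good_beside[OF slope_sign_cases T(2)] rational_good_above[OF slope_sign_cases T(2)]
    unfolding rational_value_def by (cases h) auto
qed

lemma rational_value_funpow:
  assumes "rational_value (slope_sign b) T"
  shows "rational_value (slope_sign b)
    (((\<lambda>S. if h then beside S [Cross b 0] else above S [Cross b 0]) ^^ m) T)"
proof (induction m)
  case (Suc m)
  then show ?case using rational_value_step by (simp only: funpow.simps o_apply)
qed (simp add: assms)

lemma rational_value_twist:
  assumes "rational_value (slope_sign b) T" "slope_sign b * a \<ge> 1"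
  shows "rational_value (slope_sign b) (twist h a T)"
proof -
  have "(a > 0) = b" using assms(2) by (cases b) (auto simp: slope_sign_def)
  then show ?thesis
    unfolding twist_def by (simp only: rational_value_funpow[OF assms(1)])
qed

lemma rational_value_twists:
  assumes "rational_value (slope_sign b) T" "\<forall>a \<in> set as. slope_sign b * a \<ge> 1"
  shows "rational_value (slope_sign b) (twists h as T)"
  using assms by (induction as arbitrary: h T) (simp_all add: rational_value_twist)

text \<open>The initial tangles are not \<open>good\<close>, as one of \<open>F\<close> and
  \<open>G\<close> vanishes and has no keys. The first half twist is therefore split off: it yields
  the values of a single crossing.\<close>

lemma rational_value_conway:
  assumes "as \<noteq> []" "\<forall>a \<in> set as. slope_sign b * a \<ge> 1"
  shows "rational_value (slope_sign b) (conway h as)"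
proof -
  let ?T = "if h then tangle_0 else tangle_inf"
  obtain a as' where as: "as = a # as'" using assms(1) by (cases as) auto
  have a: "(a > 0) = b" "nat \<bar>a\<bar> > 0" using assms(2) by (cases b; auto simp: as slope_sign_def)+
  then obtain m where m: "nat \<bar>a\<bar> = Suc m" using gr0_implies_Suc by blast
  let ?f = "\<lambda>S. if h then beside S [Cross b 0] else above S [Cross b 0]"
  have "skein (beside tangle_0 [Cross b 0]) (A_pow (- slope_sign b)) (A_pow (slope_sign b))"
    "skein (above tangle_inf [Cross b 0]) (A_pow (- slope_sign b)) (A_pow (slope_sign b))"
    using skein_beside[OF skein_tangle_0 skein_Cross[of b]] skein_above[OF skein_tangle_inf skein_Cross[of b]] by simp_all
  then have "tangle_pair (slope_sign b) (?f ?T) 1 1"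
    by (simp add: tangle_pair_def)
  then have "rational_value (slope_sign b) (?f ?T)"
    unfolding rational_value_def using rational_good_1[OF slope_sign_cases] by blast
  then have "rational_value (slope_sign b) ((?f ^^ m) (?f ?T))"
    by (rule rational_value_funpow)
  then have "rational_value (slope_sign b) (twist h a ?T)"
    unfolding twist_def m a(1) by (simp only: funpow_Suc_right o_apply)
  then show ?thesis
    using assms(2) rational_value_twists by (simp add: conway_def as)
qed

lemma row_closed:
  assumes "\<tau>s \<noteq> []" "\<forall>\<sigma> \<in> set \<tau>s. P \<sigma>" "\<And>T S. P T \<Longrightarrow> P S \<Longrightarrow> P (f T S)"
  shows "P (row f \<tau>s)"
  using assms by (induction f \<tau>s rule: row.induct) auto

text \<open>Rows formed by \<open>beside\<close> preserve one half of \<open>rational_good\<close>,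
  rows formed by \<open>above\<close> the other. The cone, gap and intersection conditions on
  \<open>F\<close> and \<open>G\<close> are common to both alternatives.\<close>

lemma product_extends_tangle_pair:
  assumes "product_extends b \<tau>"
  obtains r F G where "tangle_pair (slope_sign b) \<tau> F G"
    "good (slope_sign b) r F G \<or> good (- slope_sign b) r G F"
proof -
  let ?e = "slope_sign b"
  obtain \<tau>s where \<tau>s: "\<tau>s \<noteq> []" "\<forall>\<sigma> \<in> set \<tau>s. rational_extends b \<sigma>" "\<tau> = row beside \<tau>s \<or> \<tau> = row above \<tau>s"
    using assms by (auto simp: product_extends_def)
  have rat: "\<forall>\<sigma> \<in> set \<tau>s. rational_value ?e \<sigma>"
    using \<tau>s(2) by (auto simp: rational_extends_def intro: rational_value_conway)
  from \<tau>s(3) show thesis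
  proof
    assume "\<tau> = row beside \<tau>s"
    moreover have "\<exists>r F G. tangle_pair ?e (row beside \<tau>s) F G \<and> good ?e r F G"
    proof (rule row_closed[OF \<tau>s(1)])
      show "\<forall>\<sigma> \<in> set \<tau>s. \<exists>r F G. tangle_pair ?e \<sigma> F G \<and> good ?e r F G"
        using rat unfolding rational_value_def rational_good_def by blast
    qed (use tangle_pair_beside[OF slope_sign_cases] good_beside[OF slope_sign_cases] in blast)
    ultimately show thesis using that by blast
  next
    assume "\<tau> = row above \<tau>s"
    moreover have "\<exists>r F G. tangle_pair ?e (row above \<tau>s) F G \<and> good (- ?e) r G F"
    proof (rule row_closed[OF \<tau>s(1)])
      show "\<forall>\<sigma> \<in> set \<tau>s. \<exists>r F G. tangle_pair ?e \<sigma> F G \<and> good (- ?e) r G F"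
        using rat unfolding rational_value_def rational_good_def by blast
    next
      fix T S
      assume "\<exists>r F G. tangle_pair ?e T F G \<and> good (- ?e) r G F" "\<exists>r F G. tangle_pair ?e S F G \<and> good (- ?e) r G F"
      then obtain r F G r' F' G' where T: "tangle_pair ?e T F G" "good (- ?e) r G F"
        and S: "tangle_pair ?e S F' G'" "good (- ?e) r' G' F'" by blast
      have e: "- ?e = 1 \<or> - ?e = - 1" by (simp add: slope_sign_def)
      from tangle_pair_above[OF slope_sign_cases T(1) S(1)] good_beside[OF e T(2) S(2)]
      show "\<exists>r F G. tangle_pair ?e (above T S) F G \<and> good (- ?e) r G F" by (auto simp: algebra_simps)
    qed
    ultimately show thesis using that by blast
  qed
qed


section \<open>Orientations, determinants and the theorem\<close>

lemma orientation_snoc: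
  assumes "orientation u os" "coherent t (os ! length u) ys"
  shows "orientation (u @ [t]) (os @ [ys])"
  using assms by (auto simp: orientation_def nth_append less_Suc_eq)

text \<open>
  \<open>ls\<close> attaches to each strand at the top level a component and its direction in a reference
  orientation of that component; \<open>\<phi>\<close> tells which of the components are to be directed that way.
\<close>

lemma orientations_tangle:
  assumes "tangle 0 u n"
  shows "\<exists>ls :: (nat \<times> bool) list. distinct ls \<and> length ls = n \<and>
    (\<forall>\<phi>. \<exists>os. orientation u os \<and> os ! length u = map (\<lambda>(l, b). \<phi> l = b) ls)"
  using assms
proof (induction u arbitrary: n rule: rev_induct)
  case Nil
  then show ?case by (auto simp: orientation_def intro!: exI[of _ "[[]]"])
next
  case (snoc t u)
  obtain k where k: "tangle 0 u k" "tangle k [t] n" using snoc.prems by (auto simp: tangle_append)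
  obtain ls :: "(nat \<times> bool) list" where ls: "distinct ls" "length ls = k"
    "\<And>\<phi>. \<exists>os. orientation u os \<and> os ! length u = map (\<lambda>(l, b). \<phi> l = b) ls"
    using snoc.IH[OF k(1)] by blast
  have step: ?case if ls': "distinct ls'" "length ls' = n"
    and coh: "\<And>\<phi>. \<exists>\<phi>'. coherent t (map (\<lambda>(l, b). \<phi>' l = b) ls) (map (\<lambda>(l, b). \<phi> l = b) ls')" for ls' :: "(nat \<times> bool) list"
  proof (intro exI[of _ ls'] conjI allI ls')
    fix \<phi>
    obtain \<phi>' where c: "coherent t (map (\<lambda>(l, b). \<phi>' l = b) ls) (map (\<lambda>(l, b). \<phi> l = b) ls')" using coh by blast
    obtain os where os: "orientation u os" "os ! length u = map (\<lambda>(l, b). \<phi>' l = b) ls" using ls(3) by blast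
    have "orientation (u @ [t]) (os @ [map (\<lambda>(l, b). \<phi> l = b) ls'])"
      using orientation_snoc[OF os(1)] os(2) c by simp
    moreover have "length os = length u + 1" using os(1) by (simp add: orientation_def)
    ultimately show "\<exists>os. orientation (u @ [t]) os \<and> os ! length (u @ [t]) = map (\<lambda>(l, b). \<phi> l = b) ls'"
      by (intro exI[of _ "os @ [map (\<lambda>(l, b). \<phi> l = b) ls']"]) (simp add: nth_append)
  qed
  show ?case
  proof (cases t)
    case (Cup i)
    obtain l where l: "l \<notin> fst ` set ls" using ex_new_if_finite[OF infinite_UNIV_nat, of "fst ` set ls"] by auto
    have d: "distinct (take i ls @ drop i ls)" using ls(1) by simp
    have "set (take i ls) \<subseteq> set ls" "set (drop i ls) \<subseteq> set ls" by (auto dest: in_set_takeD in_set_dropD)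
    then have "(l, b) \<notin> set (take i ls)" "(l, b) \<notin> set (drop i ls)" for b using l by force+
    then have "distinct (take i ls @ [(l, True), (l, False)] @ drop i ls)" using d by (auto simp del: append_take_drop_id)
    then show ?thesis
    proof (rule step)
      show "\<exists>\<phi>'. coherent t (map (\<lambda>(l, b). \<phi>' l = b) ls)
          (map (\<lambda>(l, b). \<phi> l = b) (take i ls @ [(l, True), (l, False)] @ drop i ls))" for \<phi>
        using Cup by (intro exI[of _ \<phi>]) (simp add: take_map drop_map)
    qed (use k(2) ls(2) Cup in simp)
  next
    case (Cross b i)
    then have "distinct (ls[i := ls ! (i + 1), i + 1 := ls ! i])" using k ls by (subst distinct_swap) auto
    then show ?thesis
    proof (rule step)
      show "\<exists>\<phi>'. coherent t (map (\<lambda>(l, b). \<phi>' l = b) ls)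
          (map (\<lambda>(l, b). \<phi> l = b) (ls[i := ls ! (i + 1), i + 1 := ls ! i]))" for \<phi>
        using Cross k(2) ls(2) by (intro exI[of _ \<phi>]) (simp add: map_update)
    qed (use k(2) ls(2) Cross in simp)
  next
    case (Cap i)
    then have "i + 2 \<le> length ls" using k(2) ls(2) by simp
    then obtain p s1 s2 q where "ls = p @ s1 # s2 # q" "length p = i" by (rule list_split_at2)
    then obtain a x b y where p: "ls = p @ (a, x) # (b, y) # q" "length p = i" by (cases s1; cases s2) auto
    show ?thesis
    proof (cases "a = b")
      case True
      \<comment> \<open>Distinctness of \<open>ls\<close> is the invariant that lets a maximum close
        up a component: its two ends carry opposite directions.\<close>
      then have "x \<noteq> y" using ls(1) p by auto
      show ?thesis
      proof (rule step[of "p @ q"])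
        show "\<exists>\<phi>'. coherent t (map (\<lambda>(l, b). \<phi>' l = b) ls) (map (\<lambda>(l, b). \<phi> l = b) (p @ q))" for \<phi>
          using True \<open>x \<noteq> y\<close> p Cap by (intro exI[of _ \<phi>]) auto
      qed (use ls p k(2) Cap in auto)
    next
      case False
      \<comment> \<open>The component \<open>b\<close> is absorbed by \<open>a\<close>, and its
        reference direction is kept or reversed so that the end \<open>(b, y)\<close> becomes
        opposite to \<open>(a, x)\<close>.\<close>
      define \<rho> where "\<rho> = (\<lambda>(l, z). if l = b then (a, (z = y) = (\<not> x)) else (l, z))"
      show ?thesis
      proof (rule step[of "map \<rho> (p @ q)"])
        have "inj_on \<rho> (set (p @ q))"
        proof (rule inj_onI)
          fix s s' assume s: "s \<in> set (p @ q)" "s' \<in> set (p @ q)" "\<rho> s = \<rho> s'"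
          moreover have "(a, x) \<notin> set (p @ q)" "(b, y) \<notin> set (p @ q)" using ls(1) p by auto
          moreover obtain l z l' z' where "s = (l, z)" "s' = (l', z')" by (cases s; cases s')
          ultimately show "s = s'" by (cases x; cases y; cases z; cases z'; auto simp: \<rho>_def split: if_splits)
        qed
        then show "distinct (map \<rho> (p @ q))"
          using ls(1) p by (auto simp: distinct_map simp del: map_append)
        fix \<phi>
        define \<phi>' where "\<phi>' = \<phi>(b := ((\<phi> a = x) \<noteq> y))"
        have "(case \<rho> s of (l, b) \<Rightarrow> \<phi> l = b) = (case s of (l, b) \<Rightarrow> \<phi>' l = b)" for s
          using False by (cases s; cases x; cases y; cases "\<phi> a") (auto simp: \<rho>_def \<phi>'_def)
        then have "map (\<lambda>(l, b). \<phi> l = b) (map \<rho> w) = map (\<lambda>(l, b). \<phi>' l = b) w" for w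
          by simp
        then have "coherent t (map (\<lambda>(l, b). \<phi>' l = b) ls) (map (\<lambda>(l, b). \<phi> l = b) (map \<rho> (p @ q)))"
          unfolding p(1) using False p(2) Cap
          by (auto simp del: map_map intro!: exI[of _ "\<phi>' a = x"] simp: \<phi>'_def)
        then show "\<exists>\<phi>'. coherent t (map (\<lambda>(l, b). \<phi>' l = b) ls) (map (\<lambda>(l, b). \<phi> l = b) (map \<rho> (p @ q)))"
          by blast
      qed (use ls p k(2) Cap in auto)
    qed
  qed
qed

text \<open>The definite description in \<open>link_det\<close> denotes a value only if some
  orientation exists.\<close>

lemma orientation_exists: "link_diagram D \<Longrightarrow> \<exists>os. orientation D os"
  using orientations_tangle[of D 0] by (auto simp: link_diagram_def)

section \<open>Parity of exponents, and passing between the bracket and the Jones polynomial\<close>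

fun is_cross :: "slice \<Rightarrow> bool" where
  "is_cross (Cross b i) = True"
| "is_cross _ = False"

abbreviation crossings :: "diagram \<Rightarrow> int" where
  "crossings w \<equiv> int (length (filter is_cross w))"

lemma even_crossing_sign_sum:
  "even ((\<Sum>k < length w. crossing_sign (w ! k) (g k)) - crossings w)"
proof (induction w arbitrary: g)
  case (Cons t w)
  have "even (crossing_sign t (g 0) - (if is_cross t then 1 else 0))"
    by (cases t) (auto simp: slope_sign_def)
  from dvd_add[OF this Cons.IH[of "\<lambda>k. g (Suc k)"]] show ?case
    by (cases "is_cross t") (simp_all add: sum.lessThan_Suc_shift algebra_simps del: sum.lessThan_Suc)
qed simp

definition exponents_parity :: "int \<Rightarrow> laurent \<Rightarrow> bool" where
  "exponents_parity c P \<longleftrightarrow> (\<forall>k \<in> Poly_Mapping.keys P. even (k - c))"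

lemma exponents_parity_add:
  "exponents_parity c P \<Longrightarrow> exponents_parity c Q \<Longrightarrow> exponents_parity c (P + Q)"
  unfolding exponents_parity_def using keys_add[of P Q] by blast

lemma exponents_parity_mult:
  assumes "exponents_parity c P" "exponents_parity d Q"
  shows "exponents_parity (c + d) (P * Q)"
  unfolding exponents_parity_def
proof
  fix k assume "k \<in> Poly_Mapping.keys (P * Q)"
  then obtain a b where "k = a + b" "a \<in> Poly_Mapping.keys P" "b \<in> Poly_Mapping.keys Q"
    using keys_mult[of P Q] by blast
  then show "even (k - (c + d))"
    using assms unfolding exponents_parity_def by (metis add_diff_add dvd_add)
qed

lemma exponents_parity_A_pow: "even (k - c) \<Longrightarrow> exponents_parity c (A_pow k)"
  by (simp add: exponents_parity_def A_pow_def)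

lemma exponents_parity_loop_value: "exponents_parity 0 (loop_value ^ n)"
proof (induction n)
  case (Suc n)
  have "exponents_parity 0 (- A_pow (- 2) + - A_pow 2)"
    by (intro exponents_parity_add) (simp_all add: exponents_parity_def A_pow_def)
  then show ?case using exponents_parity_mult[of 0 loop_value 0, OF _ Suc] by (simp add: loop_value_def)
qed (simp add: exponents_parity_def)

lemma exponents_parity_bracket_acc: "exponents_parity (crossings w) (bracket_acc u w)"
proof (induction u w rule: bracket_acc.induct)
  case (4 u b i w)
  have "exponents_parity (1 + crossings w) (bracket_acc u (Cross b i # w))"
    unfolding bracket_acc.simps
    by (intro exponents_parity_add exponents_parity_mult 4 exponents_parity_A_pow) auto
  then show ?case by simp
qed (simp_all add: exponents_parity_loop_value)

text \<open>\<open>jones\<close> reads off only even exponents of \<open>A\<close>. The writhe and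
  the exponents of the bracket both have the parity of the number of crossings, so no coefficient is
  lost.\<close>

lemma even_keys_bracket_writhe:
  assumes "k \<in> Poly_Mapping.keys (bracket D)"
  shows "even (3 * writhe D os - k)"
proof -
  have "even (k - crossings D)"
    using assms exponents_parity_bracket_acc[of D "[]"] by (simp add: exponents_parity_def bracket_def)
  moreover have "even (writhe D os - crossings D)"
    unfolding writhe_def by (rule even_crossing_sign_sum)
  ultimately show ?thesis by presburger
qed

lemma inj_neg_double: "inj (\<lambda>k :: int. - 2 * k)"
  by (auto simp: inj_def)

lemma lookup_jones:
  "Poly_Mapping.lookup (jones D os) k
    = (if even (writhe D os) then 1 else - 1) * Poly_Mapping.lookup (bracket D) (3 * writhe D os - 2 * k)"
  unfolding jones_def map_key.rep_eq[OF inj_neg_double] o_apply lookup_single_mult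
  by (simp add: algebra_simps)

lemma keys_jones: "k \<in> Poly_Mapping.keys (jones D os) \<longleftrightarrow> 3 * writhe D os - 2 * k \<in> Poly_Mapping.keys (bracket D)"
  by (simp add: in_keys_iff lookup_jones)

lemma keys_bracket:
  "j \<in> Poly_Mapping.keys (bracket D) \<longleftrightarrow> (\<exists>k \<in> Poly_Mapping.keys (jones D os). j = 3 * writhe D os - 2 * k)"
proof
  assume j: "j \<in> Poly_Mapping.keys (bracket D)"
  then obtain k where "3 * writhe D os - j = 2 * k" using even_keys_bracket_writhe by blast
  then have "j = 3 * writhe D os - 2 * k" by simp
  then show "\<exists>k \<in> Poly_Mapping.keys (jones D os). j = 3 * writhe D os - 2 * k" using j by (auto simp: keys_jones)
qed (auto simp: keys_jones)

lemma no_gaps_keys: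
  "no_gaps V \<longleftrightarrow> (\<exists>s m. Poly_Mapping.keys V = (\<lambda>i. s + 2 * int i) ` {..m})"
proof
  assume "no_gaps V"
  then obtain s m a where V: "V = (\<Sum>i\<le>m. Poly_Mapping.single (s + 2 * int i) (a i))"
    and a: "a 0 \<noteq> 0" "a m \<noteq> 0" "\<forall>i<m. a i * a (i + 1) \<noteq> 0"
    unfolding no_gaps_def by blast
  have nz: "a i \<noteq> 0" if "i \<le> m" for i using that a by (cases "i = m") auto
  have "Poly_Mapping.lookup V k = (\<Sum>i\<le>m. if s + 2 * int i = k then a i else 0)" for k
    by (simp add: V lookup_sum lookup_single when_def)
  moreover have "(\<Sum>i\<le>m. if s + 2 * int i = k then a i else 0) \<noteq> 0 \<longleftrightarrow> k \<in> (\<lambda>i. s + 2 * int i) ` {..m}" for k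
  proof (cases "k \<in> (\<lambda>i. s + 2 * int i) ` {..m}")
    case True
    then obtain j where j: "j \<le> m" "k = s + 2 * int j" by blast
    then have "(\<Sum>i\<le>m. if s + 2 * int i = k then a i else 0) = (\<Sum>i\<le>m. if i = j then a i else 0)"
      by (intro sum.cong) auto
    then show ?thesis using True j nz by simp
  next
    case False
    then have "(\<Sum>i\<le>m. if s + 2 * int i = k then a i else 0) = 0" by (intro sum.neutral) auto
    then show ?thesis using False by simp
  qed
  ultimately have "Poly_Mapping.keys V = (\<lambda>i. s + 2 * int i) ` {..m}"
    by (intro set_eqI) (simp only: in_keys_iff)
  then show "\<exists>s m. Poly_Mapping.keys V = (\<lambda>i. s + 2 * int i) ` {..m}" by blast
next
  assume "\<exists>s m. Poly_Mapping.keys V = (\<lambda>i. s + 2 * int i) ` {..m}"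
  then obtain s m where keys: "Poly_Mapping.keys V = (\<lambda>i. s + 2 * int i) ` {..m}" by blast
  let ?a = "\<lambda>i. Poly_Mapping.lookup V (s + 2 * int i)"
  have "V = (\<Sum>k\<in>Poly_Mapping.keys V. Poly_Mapping.single k (Poly_Mapping.lookup V k))"
    by (rule laurent_sum_monomials[symmetric])
  also have "\<dots> = (\<Sum>i\<le>m. Poly_Mapping.single (s + 2 * int i) (?a i))"
    unfolding keys by (subst sum.reindex) (auto simp: inj_on_def)
  finally have "V = (\<Sum>i\<le>m. Poly_Mapping.single (s + 2 * int i) (?a i))" .
  moreover have nz: "?a i \<noteq> 0" if "i \<le> m" for i
    using keys that by (simp flip: in_keys_iff)
  moreover have "?a i * ?a (i + 1) \<noteq> 0" if "i < m" for i
    using nz[of i] nz[of "i + 1"] that by simp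
  ultimately show "no_gaps V"
    unfolding no_gaps_def by (intro exI[of _ s] exI[of _ m] exI[of _ ?a] conjI allI impI) blast+
qed

lemma gapfree_bracket:
  assumes "no_gaps (jones D os)"
  shows "gapfree (Poly_Mapping.keys (bracket D))"
proof -
  obtain s m where V: "Poly_Mapping.keys (jones D os) = (\<lambda>i. s + 2 * int i) ` {..m}"
    using assms by (auto simp: no_gaps_keys)
  \<comment> \<open>The largest exponent of \<open>A\<close> in the bracket: the order of exponents
    is reversed, and \<open>i = 0\<close> belongs to the top.\<close>
  define t where "t = 3 * writhe D os - 2 * s"
  have keys: "j \<in> Poly_Mapping.keys (bracket D) \<longleftrightarrow> (\<exists>i\<le>m. j = t - 4 * int i)" for j
    by (auto simp: keys_bracket[of j D os] V t_def algebra_simps)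
  have "w \<in> Poly_Mapping.keys (bracket D)"
    if x: "x \<in> Poly_Mapping.keys (bracket D)" and y: "y \<in> Poly_Mapping.keys (bracket D)"
      and w: "x \<le> w" "w \<le> y" "4 dvd w - x" for x y w
  proof -
    obtain i j where ij: "i \<le> m" "x = t - 4 * int i" "j \<le> m" "y = t - 4 * int j" using x y keys by blast
    obtain l where l: "w - x = 4 * l" using w(3) by blast
    have "w = t - 4 * int (nat (int i - l))" "nat (int i - l) \<le> m" using ij l w by auto
    then show ?thesis using keys by blast
  qed
  moreover have "Poly_Mapping.keys (bracket D) \<noteq> {}" using keys[of t] by auto
  ultimately show ?thesis unfolding gapfree_def by blast
qed

text \<open>The cone puts all exponents into one class modulo 4, and gap-freeness then fills the
  class between the extreme exponents.\<close>

lemma no_gaps_jones: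
  assumes gap: "gapfree (Poly_Mapping.keys (bracket D))" and c: "cone r (bracket D)"
  shows "no_gaps (jones D os)"
proof -
  let ?K = "Poly_Mapping.keys (bracket D)"
  have ne: "?K \<noteq> {}" using gap by (simp add: gapfree_def)
  define M where "M = Max ?K"
  define \<mu> where "\<mu> = Min ?K"
  have M: "M \<in> ?K" "\<And>x. x \<in> ?K \<Longrightarrow> x \<le> M" and \<mu>: "\<mu> \<in> ?K" "\<And>x. x \<in> ?K \<Longrightarrow> \<mu> \<le> x"
    using ne by (auto simp: M_def \<mu>_def)
  have four: "4 dvd x - y" if "x \<in> ?K" "y \<in> ?K" for x y
    using dvd_diff[OF cone_keys[OF c that(1)] cone_keys[OF c that(2)]] by simp
  obtain l where l: "M - \<mu> = 4 * l" using four[OF M(1) \<mu>(1)] by blast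
  \<comment> \<open>The largest exponent of \<open>A\<close> becomes the lowest exponent
    \<open>s\<close> of the Jones polynomial.\<close>
  obtain s where s: "3 * writhe D os - M = 2 * s" using even_keys_bracket_writhe[OF M(1)] by blast
  have "Poly_Mapping.keys (jones D os) = (\<lambda>i. s + 2 * int i) ` {..nat l}"
  proof (intro set_eqI iffI)
    fix k assume "k \<in> Poly_Mapping.keys (jones D os)"
    then have K: "3 * writhe D os - 2 * k \<in> ?K" by (simp add: keys_jones)
    obtain i where i: "M - (3 * writhe D os - 2 * k) = 4 * i" using four[OF M(1) K] by blast
    have "k = s + 2 * int (nat i)" "nat i \<le> nat l" using i s l M(2)[OF K] \<mu>(2)[OF K] by auto
    then show "k \<in> (\<lambda>i. s + 2 * int i) ` {..nat l}" by blast
  next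
    fix k assume "k \<in> (\<lambda>i. s + 2 * int i) ` {..nat l}"
    then obtain i where i: "i \<le> nat l" "k = s + 2 * int i" by blast
    have "\<mu> \<le> M - 4 * int i" using i(1) l \<mu>(2)[OF M(1)] by linarith
    have "3 * writhe D os - 2 * k = M - 4 * int i" using i(2) s by simp
    moreover have "M - 4 * int i \<in> ?K"
      using gapfree_between[OF gap M(1) \<mu>(1) four[OF M(1) \<mu>(1)], of "M - 4 * int i"]
        \<open>\<mu> \<le> M - 4 * int i\<close> by simp
    ultimately show "k \<in> Poly_Mapping.keys (jones D os)" by (simp add: keys_jones)
  qed
  then show ?thesis unfolding no_gaps_keys by blast
qed

text \<open>The powers of the primitive eighth root of unity \<open>A\<close> with \<open>A\<^sup>-\<^sup>2 = \<i>\<close>.\<close>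

definition zeta8_pow :: "int \<Rightarrow> complex" where
  "zeta8_pow k = cis (- (pi / 4) * of_int k)"

lemma zeta8_pow_add: "zeta8_pow (k + l) = zeta8_pow k * zeta8_pow l"
  by (simp add: zeta8_pow_def cis_mult algebra_simps add_divide_distrib)

lemma cmod_zeta8_pow [simp]: "cmod (zeta8_pow k) = 1"
  by (simp add: zeta8_pow_def)

lemma zeta8_pow_ii: "zeta8_pow (- 2 * k) = \<i> powi k"
proof -
  have "\<i> powi k = cis (pi / 2) powi k" by simp
  also have "\<dots> = zeta8_pow (- 2 * k)" unfolding cis_power_int by (simp add: zeta8_pow_def algebra_simps)
  finally show ?thesis by simp
qed

lemma zeta8_pow_4: "zeta8_pow 4 = - 1"
  using cis_inverse[of pi] by (simp add: zeta8_pow_def)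

lemma zeta8_pow_8: "8 dvd k - l \<longleftrightarrow> zeta8_pow k = zeta8_pow l"
proof -
  have eq1: "zeta8_pow j = 1 \<longleftrightarrow> 8 dvd j" for j
  proof
    assume "zeta8_pow j = 1"
    then have "cos (- (pi / 4) * of_int j) = 1" by (metis cis.sel(1) one_complex.sel(1) zeta8_pow_def)
    then obtain n :: int where "- (pi / 4) * of_int j = of_int n * 2 * pi"
      using cos_one_2pi_int[THEN iffD1] by blast
    then have "pi * of_int j = pi * of_int (8 * (- n))" by (simp add: field_simps)
    then have "j = 8 * (- n)" by (metis mult_cancel_left of_int_eq_iff pi_neq_zero)
    then show "8 dvd j" by simp
  next
    assume "8 dvd j"
    then obtain n where "j = 4 * n + 4 * n" by auto
    then have "zeta8_pow j = (zeta8_pow (4 * n))\<^sup>2" by (simp only: zeta8_pow_add power2_eq_square)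
    moreover have "zeta8_pow (4 * n) = (- 1) powi n"
      unfolding zeta8_pow_4[symmetric] by (simp add: zeta8_pow_def cis_power_int algebra_simps)
    ultimately show "zeta8_pow j = 1" by (simp add: power_int_def power2_eq_square flip: power_mult_distrib)
  qed
  have "zeta8_pow k = zeta8_pow (k - l) * zeta8_pow l" by (simp flip: zeta8_pow_add)
  then have "zeta8_pow k = zeta8_pow l \<longleftrightarrow> zeta8_pow (k - l) = 1"
    by (metis cmod_zeta8_pow mult_cancel_right1 norm_zero zero_neq_one)
  then show ?thesis using eq1 by simp
qed

section \<open>The determinant as a value of the bracket at an eighth root of unity\<close>

definition eval_zeta8 :: "laurent \<Rightarrow> complex" where
  "eval_zeta8 P = (\<Sum>k\<in>Poly_Mapping.keys P. of_int (Poly_Mapping.lookup P k) * zeta8_pow k)"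

lemma eval_zeta8_superset:
  assumes "finite S" "Poly_Mapping.keys P \<subseteq> S"
  shows "eval_zeta8 P = (\<Sum>k\<in>S. of_int (Poly_Mapping.lookup P k) * zeta8_pow k)"
  unfolding eval_zeta8_def using assms by (intro sum.mono_neutral_left) (auto simp: in_keys_iff)

lemma eval_zeta8_add: "eval_zeta8 (P + Q) = eval_zeta8 P + eval_zeta8 Q"
proof -
  let ?S = "Poly_Mapping.keys P \<union> Poly_Mapping.keys Q"
  have "Poly_Mapping.keys (P + Q) \<subseteq> ?S" by (rule keys_add)
  then show ?thesis
    by (simp add: eval_zeta8_superset[of ?S] lookup_add ring_distribs sum.distrib)
qed

lemma eval_zeta8_single_mult: "eval_zeta8 (Poly_Mapping.single k c * P) = of_int c * zeta8_pow k * eval_zeta8 P"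
proof -
  let ?S = "(+) k ` Poly_Mapping.keys P"
  have "Poly_Mapping.keys (Poly_Mapping.single k c * P) \<subseteq> ?S"
  proof
    fix j assume "j \<in> Poly_Mapping.keys (Poly_Mapping.single k c * P)"
    then have "j - k \<in> Poly_Mapping.keys P" by (auto simp: in_keys_iff lookup_single_mult)
    then show "j \<in> ?S" by (metis add_diff_cancel_left' image_iff add.commute diff_add_cancel)
  qed
  then have "eval_zeta8 (Poly_Mapping.single k c * P)
      = (\<Sum>j\<in>?S. of_int (Poly_Mapping.lookup (Poly_Mapping.single k c * P) j) * zeta8_pow j)"
    by (intro eval_zeta8_superset) auto
  also have "\<dots> = (\<Sum>j\<in>Poly_Mapping.keys P. of_int c * zeta8_pow k * (of_int (Poly_Mapping.lookup P j) * zeta8_pow j))"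
    by (subst sum.reindex) (simp_all add: lookup_single_mult zeta8_pow_add mult.assoc mult.left_commute)
  finally show ?thesis by (simp add: eval_zeta8_def sum_distrib_left)
qed

lemma cmod_eval_zeta8_unit: "laurent_unit u \<Longrightarrow> cmod (eval_zeta8 (u * P)) = cmod (eval_zeta8 P)"
proof -
  assume "laurent_unit u"
  then obtain k c where "u = Poly_Mapping.single k c" "c = 1 \<or> c = - 1"
    by (auto simp: laurent_unit_def A_pow_def simp flip: single_uminus)
  then show ?thesis by (auto simp: eval_zeta8_single_mult norm_mult)
qed

text \<open>The normalising factor takes a value of modulus 1, so the writhe, and with it the
  orientation, drops out.\<close>

lemma cmod_eval_minus_one: "cmod (eval_minus_one (jones D os)) = cmod (eval_zeta8 (bracket D))"
proof -
  let ?w = "3 * writhe D os" and ?c = "if even (writhe D os) then 1 else - 1 :: int"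
  have "eval_minus_one (jones D os)
      = (\<Sum>k\<in>Poly_Mapping.keys (jones D os). of_int ?c * zeta8_pow (- ?w) *
          (of_int (Poly_Mapping.lookup (bracket D) (?w - 2 * k)) * zeta8_pow (?w - 2 * k)))"
    unfolding eval_minus_one_def
  proof (rule sum.cong[OF refl])
    fix k
    have "\<i> powi k = zeta8_pow (- ?w + (?w - 2 * k))" by (simp flip: zeta8_pow_ii)
    then show "of_int (Poly_Mapping.lookup (jones D os) k) * \<i> powi k = of_int ?c * zeta8_pow (- ?w) *
          (of_int (Poly_Mapping.lookup (bracket D) (?w - 2 * k)) * zeta8_pow (?w - 2 * k))"
      unfolding zeta8_pow_add lookup_jones by simp
  qed
  also have "\<dots> = of_int ?c * zeta8_pow (- ?w) * eval_zeta8 (bracket D)"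
  proof -
    have "Poly_Mapping.keys (bracket D) = (\<lambda>k. ?w - 2 * k) ` Poly_Mapping.keys (jones D os)"
      using keys_bracket[of _ D os] by blast
    then have "eval_zeta8 (bracket D) = (\<Sum>k\<in>Poly_Mapping.keys (jones D os).
        of_int (Poly_Mapping.lookup (bracket D) (?w - 2 * k)) * zeta8_pow (?w - 2 * k))"
      unfolding eval_zeta8_def by (simp add: sum.reindex inj_on_def)
    then show ?thesis by (simp add: sum_distrib_left)
  qed
  finally show ?thesis by (simp add: norm_mult)
qed

text \<open>Well-definedness of the determinant: orientations drop out, and brackets of isotopic
  diagrams differ by a unit, whose value has modulus 1.\<close>

lemma link_det_eq:
  assumes "link_diagram D"
  shows "link_det (link_of D) = cmod (eval_zeta8 (bracket D))"
  unfolding link_det_def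
proof (rule the_equality)
  obtain os where "orientation D os" using orientation_exists[OF assms] by blast
  moreover have "D \<in> link_of D" by (simp add: link_of_def isotopic_def)
  ultimately show "\<exists>V. jones_polynomial (link_of D) V \<and> cmod (eval_zeta8 (bracket D)) = cmod (eval_minus_one V)"
    unfolding jones_polynomial_def using cmod_eval_minus_one by metis
next
  fix d assume "\<exists>V. jones_polynomial (link_of D) V \<and> d = cmod (eval_minus_one V)"
  then obtain E os where "isotopic D E" "d = cmod (eval_zeta8 (bracket E))"
    by (auto simp: jones_polynomial_def link_of_def cmod_eval_minus_one)
  then show "d = cmod (eval_zeta8 (bracket D))"
    by (metis bracket_isotopic cmod_eval_zeta8_unit)
qed

text \<open>Raising the exponent by 4 negates the power of the root of unity just as the cone
  switches the sign of the coefficient, so all terms point in the direction of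
  \<open>zeta8_pow r\<close>.\<close>

lemma eval_zeta8_cone:
  assumes "cone r P"
  shows "eval_zeta8 P = of_int (\<Sum>k\<in>Poly_Mapping.keys P. \<bar>Poly_Mapping.lookup P k\<bar>) * zeta8_pow r"
proof -
  have "of_int (Poly_Mapping.lookup P k) * zeta8_pow k = of_int \<bar>Poly_Mapping.lookup P k\<bar> * zeta8_pow r"
    if k: "k \<in> Poly_Mapping.keys P" for k
  proof -
    consider "Poly_Mapping.lookup P k > 0" "8 dvd k - r" | "Poly_Mapping.lookup P k < 0" "8 dvd k - (r + 4)"
      using k assms by (auto simp: cone_def algebra_simps)
    then show ?thesis
    proof cases
      case 1 then show ?thesis by (simp add: zeta8_pow_8)
    next
      case 2 then show ?thesis by (simp add: zeta8_pow_8 zeta8_pow_add zeta8_pow_4)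
    qed
  qed
  then show ?thesis by (simp add: eval_zeta8_def sum_distrib_right)
qed

lemma cone_unit_mult:
  assumes "laurent_unit u" "cone r P"
  obtains s where "cone s (u * P)"
proof -
  obtain k where "u = Poly_Mapping.single k 1 \<or> u = Poly_Mapping.single k (- 1)"
    using assms(1) by (auto simp: laurent_unit_def A_pow_def simp flip: single_uminus)
  \<comment> \<open>A negative sign is absorbed by an offset of 4: \<open>- A_pow k\<close> lies in
    the cone of \<open>k - 4\<close>.\<close>
  then show thesis
    using that cone_single_mult[of 1 k k r P] cone_single_mult[of "- 1" k "k - 4" r P] assms(2) by auto
qed

lemma gapfree_unit_mult:
  assumes "laurent_unit u" "gapfree (Poly_Mapping.keys P)"
  shows "gapfree (Poly_Mapping.keys (u * P))"
proof -
  obtain k where "u = A_pow k \<or> u = - A_pow k"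
    using assms(1) by (auto simp: laurent_unit_def)
  then have "Poly_Mapping.keys (u * P) = Poly_Mapping.keys (A_pow k * P)"
    by auto
  then show ?thesis using gapfree_A_pow_mult[OF assms(2)] by simp
qed

text \<open>Equality in the triangle inequality for the values at the eighth root of unity.\<close>

lemma cones_of_smoothings:
  assumes D: "link_diagram D" "is_crossing D c"
    and cones: "cone r0 (bracket (smooth_0 D c))" "cone r1 (bracket (smooth_inf D c))"
    and det: "link_det (link_of (smooth_0 D c)) \<ge> 1" "link_det (link_of (smooth_inf D c)) \<ge> 1"
      "link_det (link_of D) = link_det (link_of (smooth_0 D c)) + link_det (link_of (smooth_inf D c))"
  obtains q where "cone q (A_pow 1 * bracket (smooth_0 D c))" "cone q (A_pow (- 1) * bracket (smooth_inf D c))"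
proof -
  let ?P = "A_pow 1 * bracket (smooth_0 D c)" and ?Q = "A_pow (- 1) * bracket (smooth_inf D c)"
  have "tangle 2 (smoothing_A b) 2" "tangle 2 (smoothing_B b) 2" for b
    by (auto simp: smoothing_A_def smoothing_B_def tangle_0_def tangle_inf_def)
  then have "link_diagram (smooth_0 D c)" "link_diagram (smooth_inf D c)"
    unfolding smooth_0_def smooth_inf_def using link_diagram_replace[OF D] by blast+
  note dets = link_det_eq[OF D(1)] link_det_eq[OF this(1)] link_det_eq[OF this(2)]
  have P: "cmod (eval_zeta8 ?P) = link_det (link_of (smooth_0 D c))"
    and Q: "cmod (eval_zeta8 ?Q) = link_det (link_of (smooth_inf D c))"
    unfolding dets by (simp_all add: cmod_eval_zeta8_unit laurent_unit_A_pow)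
  have cP: "cone (1 + r0) ?P" and cQ: "cone (- 1 + r1) ?Q" 
    using cone_A_pow_mult[OF cones(1), of 1] cone_A_pow_mult[OF cones(2), of "- 1"] by auto
  define n m :: real where "n = of_int (\<Sum>k\<in>Poly_Mapping.keys ?P. \<bar>Poly_Mapping.lookup ?P k\<bar>)"
    and "m = of_int (\<Sum>k\<in>Poly_Mapping.keys ?Q. \<bar>Poly_Mapping.lookup ?Q k\<bar>)"
  have n: "n \<ge> 0" "eval_zeta8 ?P = of_real n * zeta8_pow (1 + r0)"
    and m: "m \<ge> 0" "eval_zeta8 ?Q = of_real m * zeta8_pow (- 1 + r1)"
    unfolding n_def m_def of_real_of_int_eq
    by (simp_all only: eval_zeta8_cone[OF cP] eval_zeta8_cone[OF cQ] of_int_0_le_iff sum_nonneg abs_ge_zero)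
  \<comment> \<open>Both values are nonzero; if one vanished, equality in the triangle inequality
    would not compare any directions.\<close>
  have "n \<ge> 1" "m \<ge> 1" using det(1,2) P Q n m by (auto simp: norm_mult)
  have "eval_zeta8 (bracket D) = eval_zeta8 ?P + eval_zeta8 ?Q"
    unfolding bracket_skein[OF D(2)] by (rule eval_zeta8_add)
  then have "cmod (eval_zeta8 ?P + eval_zeta8 ?Q) = cmod (eval_zeta8 ?P) + cmod (eval_zeta8 ?Q)"
    using det(3) P Q dets(1) by simp
  then have "n *\<^sub>R eval_zeta8 ?Q = m *\<^sub>R eval_zeta8 ?P"
    unfolding norm_triangle_eq using n m by (simp add: norm_mult)
  then have "zeta8_pow (- 1 + r1) = zeta8_pow (1 + r0)"
    unfolding n(2) m(2) scaleR_conv_of_real using \<open>n \<ge> 1\<close> \<open>m \<ge> 1\<close> by simp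
  \<comment> \<open>Equal directions mean equal offsets modulo 8, and a cone depends on its offset
    only modulo 8.\<close>
  then have "8 dvd (- 1 + r1) - (1 + r0)" by (simp only: zeta8_pow_8)
  then show thesis using that cP cone_cong[OF cQ] by blast
qed

lemma cone_isotopic:
  assumes "isotopic D E" "cone r (bracket D)"
  obtains s where "cone s (bracket E)"
  using bracket_isotopic[OF assms(1)] cone_unit_mult[OF _ assms(2)] by metis

text \<open>The unknot has bracket 1, and at a resolution the two smoothings contribute to a common
  cone. Membership concerns links, so every diagram is covered; changing the diagram costs only a
  unit.\<close>

lemma cone_quasi_alternating:
  assumes "L \<in> quasi_alternating_links" "D \<in> L"
  shows "\<exists>r. cone r (bracket D)"
  using assms
proof (induction arbitrary: D rule: quasi_alternating_links.induct)
  case unknot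
  have "cone 0 (bracket [Cup 0, Cap 0])" by (simp add: bracket_unknot cone_1)
  then show ?case using unknot cone_isotopic by (auto simp: unknot_def link_of_def) metis
next
  case (resolve D c E)
  have "X \<in> link_of X" for X by (simp add: link_of_def isotopic_def)
  then obtain r0 r1 where "cone r0 (bracket (smooth_0 D c))" "cone r1 (bracket (smooth_inf D c))"
    using resolve.IH by blast
  then obtain q where "cone q (A_pow 1 * bracket (smooth_0 D c))" "cone q (A_pow (- 1) * bracket (smooth_inf D c))"
    using cones_of_smoothings[OF resolve.hyps(1,2)] resolve.hyps by metis
  then have "cone q (bracket D)" unfolding bracket_skein[OF resolve.hyps(2)] by (rule cone_add)
  then show ?case using resolve.prems cone_isotopic by (auto simp: link_of_def) metis
qed

theorem theorem2p4:
  fixes L L' :: link and D \<tau> :: diagram and c :: nat and V V' :: laurent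
  assumes "L = link_of D"
    and "quasi_alternating_at D c"
    and "product_extends (slope (D ! c)) \<tau>"
    and "L' = link_of (replace D c \<tau>)"
    and "jones_polynomial L V" and "no_gaps V"
    and "jones_polynomial L' V'"
  shows "no_gaps V'"
proof -
  have D: "link_diagram D" "is_crossing D c" and
    smoothings: "link_of (smooth_0 D c) \<in> quasi_alternating_links" "link_of (smooth_inf D c) \<in> quasi_alternating_links"
    and det: "link_det (link_of (smooth_0 D c)) \<ge> 1" "link_det (link_of (smooth_inf D c)) \<ge> 1"
      "link_det (link_of D) = link_det (link_of (smooth_0 D c)) + link_det (link_of (smooth_inf D c))"
    using assms(2) by (auto simp: quasi_alternating_at_def)
  define b e where "b = slope (D ! c)" and "e = slope_sign b"
  \<comment> \<open>With these exponents \<open>Z + N\<close> is the bracket of \<open>D\<close> for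
    either slope, and the normalising powers of \<open>tangle_pair\<close> are absorbed, so that the
    new bracket is \<open>F * Z + G * N\<close>.\<close>
  define Z N where "Z = A_pow (- e) * bracket (replace D c tangle_0)"
    and "N = A_pow e * bracket (replace D c tangle_inf)"
  have "X \<in> link_of X" for X by (simp add: link_of_def isotopic_def)
  then obtain r0 r1 where "cone r0 (bracket (smooth_0 D c))" "cone r1 (bracket (smooth_inf D c))"
    using smoothings cone_quasi_alternating by blast
  then obtain q where q: "cone q (A_pow 1 * bracket (smooth_0 D c))" "cone q (A_pow (- 1) * bracket (smooth_inf D c))"
    using cones_of_smoothings[OF D] det by metis
  have ZN: "cone q Z" "cone q N" "bracket D = Z + N"
    using q bracket_skein[OF D(2)]
    by (cases b; simp add: Z_def N_def e_def b_def[symmetric] slope_sign_def smooth_0_def smooth_inf_def smoothing_A_def smoothing_B_def)+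
  \<comment> \<open>\<open>V\<close> may come from another diagram of \<open>L\<close>; its bracket
    differs from that of \<open>D\<close> by a unit, which preserves gap-freeness.\<close>
  obtain E os where E: "isotopic D E" "V = jones E os"
    using assms(1,5) by (auto simp: jones_polynomial_def link_of_def)
  obtain u where u: "laurent_unit u" "bracket D = u * bracket E"
    using bracket_isotopic equivclp_sym E(1) unfolding isotopic_def by metis
  have "gapfree (Poly_Mapping.keys (bracket E))" using assms(6) E(2) gapfree_bracket by simp
  then have gap: "gapfree (Poly_Mapping.keys (Z + N))"
    using gapfree_unit_mult[OF u(1)] u(2) ZN(3) by simp
  obtain r F G where FG: "tangle_pair e \<tau> F G" "good e r F G \<or> good (- e) r G F"
    using product_extends_tangle_pair[OF assms(3)[folded b_def]] unfolding e_def by blast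
  then have good: "cone r F" "cone r G" "gapfree (Poly_Mapping.keys F)" "gapfree (Poly_Mapping.keys G)"
      "Poly_Mapping.keys F \<inter> Poly_Mapping.keys G \<noteq> {}"
    by (auto simp: good_def)
  have bracket: "bracket (replace D c \<tau>) = F * Z + G * N"
    using bracket_replace[OF D FG(1)[unfolded tangle_pair_def]] by (simp add: Z_def N_def mult_ac)
  have cone: "cone (r + q) (bracket (replace D c \<tau>))"
    unfolding bracket by (intro cone_add cone_mult good ZN)
  have gap': "gapfree (Poly_Mapping.keys (bracket (replace D c \<tau>)))"
    unfolding bracket by (rule gapfree_keys_combination[OF good(1,2) ZN(1,2) good(3-5) gap])
  obtain E' os' where E': "isotopic (replace D c \<tau>) E'" "V' = jones E' os'"
    using assms(4,7) by (auto simp: jones_polynomial_def link_of_def)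
  obtain u' where u': "laurent_unit u'" "bracket E' = u' * bracket (replace D c \<tau>)"
    using bracket_isotopic[OF E'(1)] .
  obtain s where "cone s (bracket E')" using cone_isotopic[OF E'(1) cone] .
  moreover have "gapfree (Poly_Mapping.keys (bracket E'))"
    using gapfree_unit_mult[OF u'(1) gap'] u'(2) by simp
  ultimately show ?thesis unfolding E'(2) by (rule no_gaps_jones[rotated])
qed

end
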